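(* Let $(X_i)_{i\ge1}$ be i.i.d. real random variables with $\mathbb{E}(X_1)=0$ and $\mathbb{V}(X_1)=1$. For each $k\ge1$ let $\nu_k$ be a positive-integer-valued random variable with finite moments of all orders, independent of the sequence $(X_i)_i$, with expectation $\mu_k=\mathbb{E}(\nu_k)$, and assume $\mu_k\to\infty$ as $k\to\infty$. Assume that there exist nonnegative numbers $K_1,K_2$ (not depending on $j$ and $k$) such that $$|\mathbb{E}(X_1^j)|\le j!\,K_1^{j-2}\qquad\text{for } j=3,4,\dots$$ and $$|\Gamma_j(\nu_k)|\le j!\,K_2^{j-1}\mu_k\qquad\text{for } j=1,2,\dots,\ k\ge1 .$$ Then for every $0<\alpha<1/2$ the sequence $$Z_{k,\alpha}:=\frac{1}{\mu_k^{1/2+\alpha}}\sum_{i=1}^{\nu_k}X_i,\qquad k\ge1,$$ satisfies an MDP with speed $\mu_k^{2\alpha}$ and rate function $J(x)=x^2/2$.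
   Context: $\mathbb V$ denotes variance. For a real random variable $X$ with finite absolute moments of all orders, the $j$-th cumulant is $\Gamma_j(X):=(-i)^j\frac{d^j}{dt^j}\log\mathbb{E}[e^{itX}]\big|_{t=0}$, $j\in\mathbb N$, where $i=\sqrt{-1}$. Convention $0^0=1$. A sequence of real random variables $(Y_k)_k$ satisfies a moderate deviation principle (MDP) with speed $v(k)$ (where $v(k)\to\infty$) and good rate function $J:\mathbb{R}\to[0,\infty]$ if: (i) for every $L\in[0,\infty)$ the level set $\{x\in\mathbb R: J(x)\le L\}$ is compact; (ii) for every open $G\subseteq\mathbb{R}$, $\liminf_{k\to\infty}\frac{1}{v(k)}\log\mathbb{P}(Y_k\in G)\ge-\inf_{x\in G}J(x)$; (iii) for every closed $A\subseteq\mathbb{R}$, $\limsup_{k\to\infty}\frac{1}{v(k)}\log\mathbb{P}(Y_k\in A)\le-\inf_{x\in A}J(x)$. *)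

theory Defs
  imports "HOL-Probability.Probability"
begin

text \<open>
  The principal branch \<open>Ln\<close> is only relevant near \<open>t = 0\<close>, where the
  characteristic function is close to \<open>1\<close>.  The value is formally complex; it is a real number
  whenever all moments of \<open>X\<close> are finite.
\<close>
definition cumulant :: "'a measure \<Rightarrow> ('a \<Rightarrow> real) \<Rightarrow> nat \<Rightarrow> complex" where
  "cumulant M X j =
     (- \<i>) ^ j *
     ((\<lambda>f t. vector_derivative f (at t)) ^^ j) (\<lambda>t::real. Ln (char (distr M borel X) t)) 0"

text \<open>
  The library's \<open>indep_var\<close> requires both random variables to take values in the same type; this
  version says that the generated sigma-algebras are independent, for arbitrary value spaces.
\<close>
definition indep_rvs ::
  "'a measure \<Rightarrow> 'b measure \<Rightarrow> ('a \<Rightarrow> 'b) \<Rightarrow> 'c measure \<Rightarrow> ('a \<Rightarrow> 'c) \<Rightarrow> bool" where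
  "indep_rvs M S X T Y \<longleftrightarrow>
     X \<in> measurable M S \<and> Y \<in> measurable M T \<and>
     prob_space.indep_set M (sets (vimage_algebra (space M) X S)) (sets (vimage_algebra (space M) Y T))"

definition log_prob :: "'a measure \<Rightarrow> 'a set \<Rightarrow> ereal" where
  "log_prob M E = (if measure M E = 0 then - \<infinity> else ereal (ln (measure M E)))"

text \<open>Sequences are indexed by \<open>k \<ge> 1\<close>; the value at \<open>k = 0\<close> is ignored.\<close>
definition satisfies_MDP ::
  "'a measure \<Rightarrow> (nat \<Rightarrow> 'a \<Rightarrow> real) \<Rightarrow> (nat \<Rightarrow> real) \<Rightarrow> (real \<Rightarrow> ereal) \<Rightarrow> bool" where
  "satisfies_MDP M Y v J \<longleftrightarrow>
     (\<forall>k\<ge>1. Y k \<in> borel_measurable M) \<and>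
     filterlim v at_top sequentially \<and>
     (\<forall>x. 0 \<le> J x) \<and>
     (\<forall>L::real. 0 \<le> L \<longrightarrow> compact {x. J x \<le> ereal L}) \<and>
     (\<forall>G. open G \<longrightarrow>
        - (INF x\<in>G. J x)
          \<le> liminf (\<lambda>k. ereal (1 / v k) * log_prob M {\<omega> \<in> space M. Y k \<omega> \<in> G})) \<and>
     (\<forall>A. closed A \<longrightarrow>
        limsup (\<lambda>k. ereal (1 / v k) * log_prob M {\<omega> \<in> space M. Y k \<omega> \<in> A})
          \<le> - (INF x\<in>A. J x))"

end

theory Submission
  imports Defs
begin

text \<open>
  Only nonnegative exponents and upper bounds on the moments of \<open>\<nu>\<^sub>k\<close> are needed.  Near \<open>0\<close> the
  characteristic function satisfies \<open>char' = L' \<cdot> char\<close> with \<open>L = Ln \<circ> char\<close>; differentiating this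
  identity \<open>n\<close> times gives the recursion
  \<open>E \<nu>\<^sup>n\<^sup>+\<^sup>1 = (\<Sum>j\<le>n. (n choose j) \<Gamma>\<^sub>j\<^sub>+\<^sub>1 E \<nu>\<^sup>n\<^sup>-\<^sup>j)\<close>, so the cumulant bounds dominate the exponential
  generating function of the moments by the solution of a differential inequality, that is,
  \<open>E exp (z \<nu>) \<le> exp (\<mu> z / (1 - K\<^sub>2 z))\<close>, while Jensen's inequality gives \<open>E exp (z \<nu>) \<ge> exp (\<mu> z)\<close>.
  Conditioning on \<open>\<nu>\<close> yields \<open>E exp (s S\<^sub>\<nu>) = E exp (z \<nu>)\<close> with
  \<open>z = ln (E exp (s X\<^sub>1)) = s\<^sup>2 / 2 + o(s\<^sup>2)\<close> and \<open>z \<ge> 0\<close>.  At \<open>s = t \<mu> powr (\<alpha> - 1/2) \<rightarrow> 0\<close> the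
  logarithmic moment generating functions, divided by the speed, therefore converge to \<open>t\<^sup>2 / 2\<close> for
  every real \<open>t\<close>, and the principle follows as in the Gaertner--Ellis theorem.
\<close>

section \<open>Moderate deviations from quadratic log-moment generating functions\<close>

lemma log_prob_le:
  assumes "measure M E \<le> b" "0 < b"
  shows "log_prob M E \<le> ereal (ln b)"
  using assms by (auto simp: log_prob_def order_less_le)

lemma log_prob_ge:
  assumes "b \<le> measure M E" "0 < b"
  shows "ereal (ln b) \<le> log_prob M E"
  using assms by (auto simp: log_prob_def)

lemma (in prob_space) expectation_exp_pos:
  assumes "integrable M (\<lambda>\<omega>. exp (X \<omega>) :: real)"
  shows "0 < expectation (\<lambda>\<omega>. exp (X \<omega>))"
  using assms by (intro expectation_greater) auto

text \<open>On the event, one of the two exponentials is at least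
  \<open>exp (v * a\<^sup>2)\<close>, so their scaled sum dominates the indicator. The tilt equals
  the threshold because \<open>t = a\<close> maximises \<open>t * a - t\<^sup>2 / 2\<close>; adding
  both signs treats the two tails with one integral.\<close>

lemma (in prob_space) two_sided_chernoff_bound:
  assumes [measurable]: "random_variable borel Y" and "0 \<le> v" "0 \<le> a"
    and int: "\<And>t. t \<in> {a, -a} \<Longrightarrow> integrable M (\<lambda>\<omega>. exp (t * v * Y \<omega>) :: real)"
  shows "prob {\<omega> \<in> space M. a \<le> \<bar>Y \<omega>\<bar>}
      \<le> exp (- v * a\<^sup>2) * (expectation (\<lambda>\<omega>. exp (a * v * Y \<omega>)) + expectation (\<lambda>\<omega>. exp (- a * v * Y \<omega>)))"
proof -
  let ?E = "{\<omega> \<in> space M. a \<le> \<bar>Y \<omega>\<bar>}"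
  have [simp]: "?E \<in> events" by measurable
  have int': "integrable M (\<lambda>\<omega>. exp (- v * a\<^sup>2) * (exp (a * v * Y \<omega>) + exp (- a * v * Y \<omega>)))"
    using int[of a] int[of "-a"] by auto
  have "prob ?E = expectation (indicator ?E)"
    by simp
  also have "\<dots> \<le> expectation (\<lambda>\<omega>. exp (- v * a\<^sup>2) * (exp (a * v * Y \<omega>) + exp (- a * v * Y \<omega>)))"
  proof (rule integral_mono'[OF int'])
    fix \<omega> assume "\<omega> \<in> space M"
    have "1 \<le> exp (v * a * (y - a))" if "a \<le> y" for y
      using that assms(2,3) by simp
    from this[of "Y \<omega>"] this[of "- Y \<omega>"]
    have "1 \<le> exp (v * a * (Y \<omega> - a)) + exp (v * a * (- Y \<omega> - a))" if "a \<le> \<bar>Y \<omega>\<bar>"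
      using that by (cases "0 \<le> Y \<omega>") (auto intro: add_increasing add_increasing2)
    also have "exp (v * a * (Y \<omega> - a)) + exp (v * a * (- Y \<omega> - a))
        = exp (- v * a\<^sup>2) * (exp (a * v * Y \<omega>) + exp (- a * v * Y \<omega>))"
      unfolding distrib_left exp_add[symmetric] by (simp add: power2_eq_square algebra_simps)
    finally show "indicator ?E \<omega> \<le> exp (- v * a\<^sup>2) * (exp (a * v * Y \<omega>) + exp (- a * v * Y \<omega>))"
      by (simp add: indicator_def)
  qed auto
  also have "\<dots> = exp (- v * a\<^sup>2) * (expectation (\<lambda>\<omega>. exp (a * v * Y \<omega>)) + expectation (\<lambda>\<omega>. exp (- a * v * Y \<omega>)))"
    using int[of a] int[of "-a"] by (simp add: Bochner_Integration.integral_add)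
  finally show ?thesis .
qed

text \<open>
  This replaces the change of measure in the lower bound: under the tilt \<open>exp (x v Y)\<close>, the mass on
  \<open>Y \<ge> x + \<delta>\<close> and on \<open>Y \<le> x - \<delta>\<close> is controlled by the neighbouring tilts \<open>x \<plusminus> \<delta>\<close>.
\<close>
lemma (in prob_space) exponential_tilting_bound:
  assumes [measurable]: "random_variable borel Y" and "0 \<le> v" "0 < \<delta>"
    and int: "\<And>t. t \<in> {x, x + \<delta>, x - \<delta>} \<Longrightarrow> integrable M (\<lambda>\<omega>. exp (t * v * Y \<omega>) :: real)"
  shows "expectation (\<lambda>\<omega>. exp (x * v * Y \<omega>))
      \<le> exp (v * (x\<^sup>2 + \<bar>x\<bar> * \<delta>)) * prob {\<omega> \<in> space M. \<bar>Y \<omega> - x\<bar> < \<delta>}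
        + exp (- (v * \<delta> * (x + \<delta>))) * expectation (\<lambda>\<omega>. exp ((x + \<delta>) * v * Y \<omega>))
        + exp (v * \<delta> * (x - \<delta>)) * expectation (\<lambda>\<omega>. exp ((x - \<delta>) * v * Y \<omega>))"
proof -
  let ?E = "{\<omega> \<in> space M. \<bar>Y \<omega> - x\<bar> < \<delta>}"
  let ?f = "\<lambda>\<omega>. exp (v * (x\<^sup>2 + \<bar>x\<bar> * \<delta>)) * indicator ?E \<omega>
      + exp (- (v * \<delta> * (x + \<delta>))) * exp ((x + \<delta>) * v * Y \<omega>)
      + exp (v * \<delta> * (x - \<delta>)) * exp ((x - \<delta>) * v * Y \<omega>)"
  have [simp]: "?E \<in> events" by measurable
  have i1: "integrable M (\<lambda>\<omega>. exp (v * (x\<^sup>2 + \<bar>x\<bar> * \<delta>)) * indicator ?E \<omega>)"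
    by (simp add: emeasure_eq_measure)
  have i2: "integrable M (\<lambda>\<omega>. exp (- (v * \<delta> * (x + \<delta>))) * exp ((x + \<delta>) * v * Y \<omega>))"
    "integrable M (\<lambda>\<omega>. exp (v * \<delta> * (x - \<delta>)) * exp ((x - \<delta>) * v * Y \<omega>))"
    using int by (intro integrable_mult_right; simp)+
  have "expectation (\<lambda>\<omega>. exp (x * v * Y \<omega>)) \<le> expectation ?f"
  proof (rule integral_mono)
    fix \<omega> assume \<omega>: "\<omega> \<in> space M"
    consider "\<bar>Y \<omega> - x\<bar> < \<delta>" | "x + \<delta> \<le> Y \<omega>" | "Y \<omega> \<le> x - \<delta>"
      by linarith
    then show "exp (x * v * Y \<omega>) \<le> ?f \<omega>"
    proof cases
      case 1
      have "x * (Y \<omega> - x) \<le> \<bar>x\<bar> * \<delta>"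
        using 1 by (metis abs_ge_self abs_mult abs_ge_zero mult_left_mono less_imp_le order_trans)
      then have "v * (x * Y \<omega>) \<le> v * (x\<^sup>2 + \<bar>x\<bar> * \<delta>)"
        using assms(2) by (intro mult_left_mono) (auto simp: power2_eq_square algebra_simps)
      then show ?thesis
        using 1 \<omega> by (auto simp: mult_ac intro!: add_increasing2)
    next
      case 2
      \<comment> \<open>Raising the tilt from \<open>x\<close> to \<open>x + \<delta>\<close>
        multiplies the integrand by \<open>exp (v * \<delta> * Y \<omega>)\<close>, which is at
        least \<open>exp (v * \<delta> * (x + \<delta>))\<close> in this case. The third case
        mirrors this with the tilt \<open>x - \<delta>\<close>.\<close>
      have "0 \<le> v * \<delta> * (Y \<omega> - (x + \<delta>))"
        using 2 assms(2,3) by (intro mult_nonneg_nonneg) auto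
      then have "exp (x * v * Y \<omega>) \<le> exp (- (v * \<delta> * (x + \<delta>))) * exp ((x + \<delta>) * v * Y \<omega>)"
        by (simp add: algebra_simps flip: exp_add)
      then show ?thesis
        by (intro add_increasing2 add_increasing) auto
    next
      case 3
      have "0 \<le> v * \<delta> * ((x - \<delta>) - Y \<omega>)"
        using 3 assms(2,3) by (intro mult_nonneg_nonneg) auto
      then have "exp (x * v * Y \<omega>) \<le> exp (v * \<delta> * (x - \<delta>)) * exp ((x - \<delta>) * v * Y \<omega>)"
        by (simp add: algebra_simps flip: exp_add)
      then show ?thesis
        by (intro add_increasing2 add_increasing) auto
    qed
  qed (use int i1 i2 in \<open>auto intro!: Bochner_Integration.integrable_add\<close>)
  also have "\<dots> = exp (v * (x\<^sup>2 + \<bar>x\<bar> * \<delta>)) * prob ?E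
        + exp (- (v * \<delta> * (x + \<delta>))) * expectation (\<lambda>\<omega>. exp ((x + \<delta>) * v * Y \<omega>))
        + exp (v * \<delta> * (x - \<delta>)) * expectation (\<lambda>\<omega>. exp ((x - \<delta>) * v * Y \<omega>))"
    using i1 i2 by (simp add: Bochner_Integration.integral_add Bochner_Integration.integrable_add)
  finally show ?thesis .
qed


section \<open>The quadratic rate function and the passage to the deviation principle\<close>

lemma compact_square_sublevel: "compact {x::real. ereal (x\<^sup>2 / 2) \<le> ereal L}"
proof -
  have "ereal (x\<^sup>2 / 2) \<le> ereal L \<longleftrightarrow> x \<in> {- sqrt (2 * L) .. sqrt (2 * L)}" for x
  proof -
    have "ereal (x\<^sup>2 / 2) \<le> ereal L \<longleftrightarrow> x\<^sup>2 \<le> 2 * L"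
      by auto
    also have "\<dots> \<longleftrightarrow> \<bar>x\<bar> \<le> sqrt (2 * L)"
      by (simp only: real_sqrt_le_iff flip: real_sqrt_abs)
    also have "\<dots> \<longleftrightarrow> x \<in> {- sqrt (2 * L) .. sqrt (2 * L)}"
      by (auto simp only: abs_le_iff atLeastAtMost_iff minus_le_iff)
    finally show ?thesis .
  qed
  then show ?thesis
    by (simp only: Collect_mem_eq compact_Icc)
qed

text \<open>This is the Gaertner-Ellis argument for the single limit \<open>t\<^sup>2 / 2\<close>,
  whose Legendre transform \<open>x\<^sup>2 / 2\<close> is explicit and attained at the tilt
  \<open>t = x\<close>. Integrability is asked only eventually in \<open>k\<close>, for each
  \<open>t\<close> separately: the range of admissible tilts may depend on \<open>k\<close>, and
  upper and lower limits ignore initial terms.\<close>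

lemma (in prob_space) MDP_of_quadratic_log_mgf:
  fixes Y :: "nat \<Rightarrow> 'a \<Rightarrow> real" and v :: "nat \<Rightarrow> real"
  assumes meas: "\<And>k. k \<ge> 1 \<Longrightarrow> random_variable borel (Y k)"
    and v: "filterlim v at_top sequentially"
    and int: "\<And>t. \<forall>\<^sub>F k in sequentially. integrable M (\<lambda>\<omega>. exp (t * v k * Y k \<omega>))"
    and lim: "\<And>t. (\<lambda>k. ln (expectation (\<lambda>\<omega>. exp (t * v k * Y k \<omega>))) / v k) \<longlonglongrightarrow> t\<^sup>2 / 2"
  shows "satisfies_MDP M Y v (\<lambda>x. ereal (x\<^sup>2 / 2))"
proof -
  define E where "E t k = expectation (\<lambda>\<omega>. exp (t * v k * Y k \<omega>))" for t k
  have v_ge: "\<forall>\<^sub>F k in sequentially. c \<le> v k" for c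
    using v by (simp add: filterlim_at_top)
  have v_gt: "\<forall>\<^sub>F k in sequentially. 0 < v k"
    using v by (simp add: filterlim_at_top_dense)
  have ev1: "\<forall>\<^sub>F k in sequentially. k \<ge> (1::nat)"
    by (rule eventually_ge_at_top)
  have E_le: "\<forall>\<^sub>F k in sequentially. E t k \<le> exp (v k * (t\<^sup>2 / 2 + \<eta>))" if "0 < \<eta>" for t \<eta>
  proof -
    have "\<forall>\<^sub>F k in sequentially. ln (E t k) / v k < t\<^sup>2 / 2 + \<eta>"
      unfolding E_def using that by (intro order_tendstoD(2)[OF lim]) auto
    then show ?thesis using v_gt int[of t]
    proof eventually_elim
      case (elim k)
      have "0 < E t k" unfolding E_def using elim by (intro expectation_exp_pos)
      moreover have "ln (E t k) \<le> v k * (t\<^sup>2 / 2 + \<eta>)"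
        using elim by (simp add: field_simps)
      ultimately show ?case by (metis exp_ln exp_le_cancel_iff)
    qed
  qed
  have E_ge: "\<forall>\<^sub>F k in sequentially. exp (v k * (t\<^sup>2 / 2 - \<eta>)) \<le> E t k" if "0 < \<eta>" for t \<eta>
  proof -
    have "\<forall>\<^sub>F k in sequentially. t\<^sup>2 / 2 - \<eta> < ln (E t k) / v k"
      unfolding E_def using that by (intro order_tendstoD(1)[OF lim]) auto
    then show ?thesis using v_gt int[of t]
    proof eventually_elim
      case (elim k)
      have "0 < E t k" unfolding E_def using elim by (intro expectation_exp_pos)
      moreover have "v k * (t\<^sup>2 / 2 - \<eta>) \<le> ln (E t k)"
        using elim by (simp add: field_simps)
      ultimately show ?case by (metis exp_ln exp_le_cancel_iff)
    qed
  qed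
  let ?L = "\<lambda>A k. ereal (1 / v k) * log_prob M {\<omega> \<in> space M. Y k \<omega> \<in> A}"

  \<comment> \<open>Stating the bound for any lower bound \<open>c\<close> of the rate on
    \<open>A\<close>, instead of for the infimum, also covers the empty set, where the infimum is
    infinite and \<open>c\<close> can be taken arbitrarily large.\<close>
  have upper: "limsup (?L A) \<le> ereal (- c)" if "0 \<le> c" and A: "\<And>x. x \<in> A \<Longrightarrow> c \<le> x\<^sup>2 / 2" for A c
  proof (rule ereal_le_epsilon2)
    fix e :: real assume "0 < e"
    \<comment> \<open>With this threshold the Chernoff exponent
      \<open>- a\<^sup>2 + a\<^sup>2 / 2\<close> is exactly \<open>- c\<close>.\<close>
    define a where "a = sqrt (2 * c)"
    have a: "0 \<le> a" "a\<^sup>2 = 2 * c" using \<open>0 \<le> c\<close> by (simp_all add: a_def)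
    have "a \<le> \<bar>x\<bar>" if "x \<in> A" for x
      using A[OF that] unfolding a_def by (intro real_le_lsqrt) auto
    note A = this
    \<comment> \<open>Half of \<open>e\<close> pays for the error in the limit of the logarithmic
      transforms, the other half for the factor 2 from the two tails:
      \<open>ln 2 / v k \<le> e / 2\<close> once \<open>v k \<ge> 2 * ln 2 / e\<close>.\<close>
    have "\<forall>\<^sub>F k in sequentially. ?L A k \<le> ereal (- c + e)"
      using E_le[OF half_gt_zero[OF \<open>0 < e\<close>], of a] E_le[OF half_gt_zero[OF \<open>0 < e\<close>], of "-a"]
        int[of a] int[of "-a"] v_gt ev1 v_ge[of "2 * ln 2 / e"]
    proof eventually_elim
      case (elim k)
      note [measurable] = meas[OF \<open>1 \<le> k\<close>]
      have "prob {\<omega> \<in> space M. Y k \<omega> \<in> A} \<le> prob {\<omega> \<in> space M. a \<le> \<bar>Y k \<omega>\<bar>}"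
        using A by (intro finite_measure_mono) auto
      also have "\<dots> \<le> exp (- v k * a\<^sup>2) * (E a k + E (- a) k)"
        unfolding E_def using elim a by (intro two_sided_chernoff_bound) auto
      also have "\<dots> \<le> exp (- v k * a\<^sup>2) * (2 * exp (v k * (a\<^sup>2 / 2 + e / 2)))"
        using elim by (intro mult_left_mono) (auto simp: field_simps)
      also have "\<dots> = 2 * exp (- v k * a\<^sup>2 + v k * (a\<^sup>2 / 2 + e / 2))"
        by (simp only: exp_add mult_ac)
      also have "- v k * a\<^sup>2 + v k * (a\<^sup>2 / 2 + e / 2) = v k * (- c + e / 2)"
        by (simp add: a algebra_simps)
      also have "2 * exp (v k * (- c + e / 2)) = exp (ln 2 + v k * (- c + e / 2))"
        by (simp add: exp_add)
      finally have "log_prob M {\<omega> \<in> space M. Y k \<omega> \<in> A} \<le> ereal (ln 2 + v k * (- c + e / 2))"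
        by (rule log_prob_le[THEN order_trans]) auto
      then have "?L A k \<le> ereal (1 / v k) * ereal (ln 2 + v k * (- c + e / 2))"
        using elim by (intro ereal_mult_left_mono) auto
      also have "\<dots> \<le> ereal (- c + e)"
        using elim \<open>0 < e\<close> by (simp add: field_simps)
      finally show ?case by simp
    qed
    then show "limsup (?L A) \<le> ereal (- c) + ereal e"
      by (simp add: Limsup_bounded)
  qed

  have lower: "ereal (- (x\<^sup>2 / 2)) \<le> liminf (?L G)" if "open G" "x \<in> G" for G x
  proof (rule ereal_le_epsilon2)
    fix e :: real assume "0 < e"
    obtain r where r: "0 < r" "\<And>y. \<bar>y - x\<bar> < r \<Longrightarrow> y \<in> G"
      using \<open>open G\<close> \<open>x \<in> G\<close> unfolding open_dist dist_real_def by blast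
    \<comment> \<open>The bound \<open>r\<close> keeps the interval around \<open>x\<close> inside
      \<open>G\<close>, the bound 1 yields \<open>\<eta> \<le> \<delta>\<close> below, and the last
      bound limits the total loss \<open>\<eta> + \<bar>x\<bar> * \<delta>\<close> in the exponent
      to \<open>e / 4\<close>.\<close>
    define \<delta> where "\<delta> = min (min r 1) (e / (4 * (\<bar>x\<bar> + 1)))"
    have "0 < \<delta>" "\<delta> \<le> r" "\<delta> \<le> 1" and "\<delta> \<le> e / (4 * (\<bar>x\<bar> + 1))"
      using r \<open>0 < e\<close> by (auto simp: \<delta>_def)
    then have \<delta>e: "(\<bar>x\<bar> + 1) * \<delta> \<le> e / 4"
      by (simp add: field_simps)
    \<comment> \<open>The neighbouring tilts contribute the exponent
      \<open>x\<^sup>2 / 2 - \<delta>\<^sup>2 / 2 + \<eta>\<close>. With this choice it equals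
      \<open>x\<^sup>2 / 2 - 3 * \<eta>\<close>, which stays below the exponent
      \<open>x\<^sup>2 / 2 - \<eta>\<close> of the main term by \<open>2 * \<eta>\<close>.\<close>
    define \<eta> where "\<eta> = \<delta>\<^sup>2 / 8"
    have "0 < \<eta>" using \<open>0 < \<delta>\<close> by (simp add: \<eta>_def)
    have "\<eta> \<le> \<delta>" unfolding \<eta>_def power2_eq_square
      using \<open>0 < \<delta>\<close> \<open>\<delta> \<le> 1\<close> mult_left_mono[of \<delta> 1 \<delta>] by simp
    then have gap: "\<eta> + \<bar>x\<bar> * \<delta> \<le> e / 4"
      using \<delta>e by (simp add: algebra_simps)
    have "\<forall>\<^sub>F k in sequentially. ereal (- (x\<^sup>2 / 2) - e) \<le> ?L G k"
      using E_ge[OF \<open>0 < \<eta>\<close>, of x] E_le[OF \<open>0 < \<eta>\<close>, of "x + \<delta>"] E_le[OF \<open>0 < \<eta>\<close>, of "x - \<delta>"]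
        int[of x] int[of "x + \<delta>"] int[of "x - \<delta>"] v_gt ev1
        v_ge[of "2 * ln 2 / e"] v_ge[of "ln 4 / (2 * \<eta>)"]
    proof eventually_elim
      case (elim k)
      note [measurable] = meas[OF \<open>1 \<le> k\<close>]
      let ?p = "prob {\<omega> \<in> space M. \<bar>Y k \<omega> - x\<bar> < \<delta>}"
      have "exp (v k * (x\<^sup>2 / 2 - \<eta>)) \<le> E x k" by fact
      also have "\<dots> \<le> exp (v k * (x\<^sup>2 + \<bar>x\<bar> * \<delta>)) * ?p
          + exp (- (v k * \<delta> * (x + \<delta>))) * E (x + \<delta>) k + exp (v k * \<delta> * (x - \<delta>)) * E (x - \<delta>) k"
        unfolding E_def using elim \<open>0 < \<delta>\<close> by (intro exponential_tilting_bound) auto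
      also have "exp (- (v k * \<delta> * (x + \<delta>))) * E (x + \<delta>) k
          \<le> exp (- (v k * \<delta> * (x + \<delta>))) * exp (v k * ((x + \<delta>)\<^sup>2 / 2 + \<eta>))"
        using elim by (intro mult_left_mono) auto
      also have "\<dots> = exp (v k * (x\<^sup>2 / 2 - 3 * \<eta>))"
        unfolding exp_add[symmetric] by (simp add: \<eta>_def power2_eq_square field_simps)
      also have "exp (v k * \<delta> * (x - \<delta>)) * E (x - \<delta>) k
          \<le> exp (v k * \<delta> * (x - \<delta>)) * exp (v k * ((x - \<delta>)\<^sup>2 / 2 + \<eta>))"
        using elim by (intro mult_left_mono) auto
      also have "\<dots> = exp (v k * (x\<^sup>2 / 2 - 3 * \<eta>))"
        unfolding exp_add[symmetric] by (simp add: \<eta>_def power2_eq_square field_simps)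
      finally have *: "exp (v k * (x\<^sup>2 / 2 - \<eta>))
          \<le> exp (v k * (x\<^sup>2 + \<bar>x\<bar> * \<delta>)) * ?p + 2 * exp (v k * (x\<^sup>2 / 2 - 3 * \<eta>))"
        by simp
      \<comment> \<open>Each of the two error terms is then at most a quarter of the left-hand side
        of \<open>*\<close>, so half of it remains for the probability.\<close>
      have "ln 4 \<le> v k * (2 * \<eta>)"
        using elim \<open>0 < \<eta>\<close> by (simp add: field_simps)
      then have "4 \<le> exp (v k * (2 * \<eta>))"
        by (metis exp_le_cancel_iff exp_ln zero_less_numeral)
      then have "4 * exp (v k * (x\<^sup>2 / 2 - 3 * \<eta>)) \<le> exp (v k * (2 * \<eta>)) * exp (v k * (x\<^sup>2 / 2 - 3 * \<eta>))"
        by (intro mult_right_mono) auto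
      also have "\<dots> = exp (v k * (x\<^sup>2 / 2 - \<eta>))"
        unfolding exp_add[symmetric] by (simp add: algebra_simps)
      finally have "exp (v k * (x\<^sup>2 / 2 - \<eta>)) / 2 \<le> exp (v k * (x\<^sup>2 + \<bar>x\<bar> * \<delta>)) * ?p"
        using * by simp
      then have "exp (v k * (x\<^sup>2 / 2 - \<eta>)) / 2 / exp (v k * (x\<^sup>2 + \<bar>x\<bar> * \<delta>)) \<le> ?p"
        by (simp only: pos_divide_le_eq[OF exp_gt_zero] mult.commute)
      moreover have "exp (v k * (x\<^sup>2 / 2 - \<eta>)) / 2 / exp (v k * (x\<^sup>2 + \<bar>x\<bar> * \<delta>))
          = exp (- ln 2 + v k * (x\<^sup>2 / 2 - \<eta>) + - (v k * (x\<^sup>2 + \<bar>x\<bar> * \<delta>)))"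
        by (simp only: exp_add exp_minus exp_ln zero_less_numeral divide_inverse mult_ac)
      ultimately have "exp (- ln 2 + v k * (x\<^sup>2 / 2 - \<eta>) + - (v k * (x\<^sup>2 + \<bar>x\<bar> * \<delta>))) \<le> ?p"
        by (simp only:)
      also have "?p \<le> prob {\<omega> \<in> space M. Y k \<omega> \<in> G}"
        using r(2) \<open>\<delta> \<le> r\<close> borel_open[OF \<open>open G\<close>] by (intro finite_measure_mono) auto
      finally have "ereal (- ln 2 + v k * (x\<^sup>2 / 2 - \<eta>) + - (v k * (x\<^sup>2 + \<bar>x\<bar> * \<delta>)))
          \<le> log_prob M {\<omega> \<in> space M. Y k \<omega> \<in> G}"
        by (rule log_prob_ge[OF _ exp_gt_zero, unfolded ln_exp])
      then have "ereal (1 / v k) * ereal (- ln 2 + v k * (x\<^sup>2 / 2 - \<eta>) + - (v k * (x\<^sup>2 + \<bar>x\<bar> * \<delta>)))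
          \<le> ?L G k"
        using elim by (intro ereal_mult_left_mono) auto
      moreover have "- (x\<^sup>2 / 2) - e \<le> 1 / v k * (- ln 2 + v k * (x\<^sup>2 / 2 - \<eta>) + - (v k * (x\<^sup>2 + \<bar>x\<bar> * \<delta>)))"
      proof -
        have "ln 2 / v k \<le> e / 2"
          using elim \<open>0 < e\<close> by (simp add: field_simps)
        moreover have "1 / v k * (- ln 2 + v k * (x\<^sup>2 / 2 - \<eta>) + - (v k * (x\<^sup>2 + \<bar>x\<bar> * \<delta>)))
            = - (ln 2 / v k) - x\<^sup>2 / 2 - (\<eta> + \<bar>x\<bar> * \<delta>)"
          using elim by (simp add: field_simps)
        ultimately show ?thesis using gap \<open>0 < e\<close> by linarith
      qed
      ultimately show ?case
        by (simp only: times_ereal.simps) (erule order_trans[rotated], simp only: ereal_less_eq)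
    qed
    then have "ereal (- (x\<^sup>2 / 2) - e) \<le> liminf (?L G)"
      by (rule Liminf_bounded)
    then have "ereal (- (x\<^sup>2 / 2) - e) + ereal e \<le> liminf (?L G) + ereal e"
      by (rule add_right_mono)
    then show "ereal (- (x\<^sup>2 / 2)) \<le> liminf (?L G) + ereal e"
      by simp
  qed

  show ?thesis
    unfolding satisfies_MDP_def
  proof (intro conjI allI impI)
    fix G :: "real set" assume "open G"
    have "- liminf (?L G) \<le> ereal (x\<^sup>2 / 2)" if "x \<in> G" for x
      using lower[OF \<open>open G\<close> that] by (subst ereal_uminus_le_reorder) simp
    then have "- liminf (?L G) \<le> (INF x\<in>G. ereal (x\<^sup>2 / 2))"
      by (rule INF_greatest)
    then show "- (INF x\<in>G. ereal (x\<^sup>2 / 2)) \<le> liminf (?L G)"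
      by (subst ereal_uminus_le_reorder)
  next
    fix A :: "real set"
    let ?I = "INF x\<in>A. ereal (x\<^sup>2 / 2)"
    have "0 \<le> ?I" by (intro INF_greatest) auto
    have I_le: "c \<le> x\<^sup>2 / 2" if "ereal c \<le> ?I" "x \<in> A" for c x
      using INF_lower[OF that(2), of "\<lambda>x. ereal (x\<^sup>2 / 2)"] that(1)
      by (simp flip: ereal_less_eq(3))
    show "limsup (?L A) \<le> - ?I"
    proof (cases ?I)
      case (real c)
      then show ?thesis using upper[of c A] I_le[of c] \<open>0 \<le> ?I\<close> by auto
    next
      case PInf
      \<comment> \<open>Here \<open>A\<close> is empty, so \<open>upper\<close> applies with every
        nonnegative constant; the \<open>max\<close> supplies this sign for an arbitrary real
        \<open>c\<close>.\<close>
      then have "limsup (?L A) \<le> ereal (- max 0 (- c))" for c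
        using upper[of "max 0 (- c)" A] I_le[of "max 0 (- c)"] by auto
      then have "limsup (?L A) \<le> ereal c" for c
        by (rule order_trans) (auto simp: max_def)
      then have "limsup (?L A) = - \<infinity>"
        by (intro ereal_bot) auto
      then show ?thesis using PInf by simp
    qed (use \<open>0 \<le> ?I\<close> in auto)
  qed (use meas v compact_square_sublevel in auto)
qed

section \<open>Moments and cumulants\<close>

lemma has_vector_derivative_of_quadratic_remainder:
  fixes f :: "real \<Rightarrow> 'b::real_normed_vector"
  assumes "\<And>s. norm (f s - f t - (s - t) *\<^sub>R D) \<le> C * (s - t)\<^sup>2"
  shows "(f has_vector_derivative D) (at t)"
  unfolding has_vector_derivative_def has_derivative_within_alt
proof (intro conjI allI impI)
  fix e :: real assume "0 < e"
  have "0 \<le> C"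
    using order_trans[OF norm_ge_zero assms[of "t + 1"]] by simp
  show "\<exists>d>0. \<forall>s\<in>UNIV. norm (s - t) < d \<longrightarrow> norm (f s - f t - (s - t) *\<^sub>R D) \<le> e * norm (s - t)"
  proof (intro exI conjI ballI impI)
    show "0 < e / (C + 1)" using \<open>0 < e\<close> \<open>0 \<le> C\<close> by simp
    fix s assume "norm (s - t) < e / (C + 1)"
    then have "(C + 1) * \<bar>s - t\<bar> \<le> e"
      using \<open>0 \<le> C\<close> by (simp add: field_simps)
    then have "C * \<bar>s - t\<bar> \<le> e"
      by (simp add: distrib_right)
    then have "C * \<bar>s - t\<bar> * \<bar>s - t\<bar> \<le> e * \<bar>s - t\<bar>"
      by (rule mult_right_mono) auto
    then show "norm (f s - f t - (s - t) *\<^sub>R D) \<le> e * norm (s - t)"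
      using assms[of s] by (simp add: power2_eq_square mult.assoc)
  qed
qed (auto intro: bounded_linear_scaleR_left)

text \<open>This is the index bookkeeping of the Leibniz rule: differentiating a product raises the
  order of one factor or of the other, and Pascal's rule collects the two resulting sums.\<close>

lemma sum_binomial_pascal:
  fixes h :: "nat \<Rightarrow> 'b::comm_semiring_1"
  shows "(\<Sum>j\<le>n. of_nat (n choose j) * (h j + h (Suc j))) = (\<Sum>j\<le>Suc n. of_nat (Suc n choose j) * h j)"
proof -
  have "(\<Sum>j\<le>n. of_nat (n choose j) * h j) = (\<Sum>j\<le>Suc n. of_nat (n choose j) * h j)"
    by (simp add: binomial_eq_0)
  also have "\<dots> = h 0 + (\<Sum>j\<le>n. of_nat (n choose Suc j) * h (Suc j))"
    by (subst sum.atMost_Suc_shift) simp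
  finally show ?thesis
    by (subst sum.atMost_Suc_shift) (simp add: distrib_left distrib_right sum.distrib add_ac)
qed

text \<open>Here \<open>f n\<close> plays the role of the \<open>n\<close>-th derivative of a
  nonvanishing function and \<open>L\<close> that of a logarithm of it. The formula is the Leibniz
  rule applied to \<open>f 1 = D 1 * f 0\<close>. An open set is used because iterated derivatives
  at a point need the identity in a neighbourhood.\<close>

lemma iterated_log_derivative_recursion:
  fixes f :: "nat \<Rightarrow> real \<Rightarrow> complex" and L :: "real \<Rightarrow> complex"
  defines "D \<equiv> \<lambda>n. ((\<lambda>g t. vector_derivative g (at t)) ^^ n) L"
  assumes f: "\<And>n t. (f n has_vector_derivative f (Suc n) t) (at t)"
    and "open S" and nz: "\<And>t. t \<in> S \<Longrightarrow> f 0 t \<noteq> 0"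
    and L: "\<And>t. t \<in> S \<Longrightarrow> (L has_vector_derivative f 1 t / f 0 t) (at t)"
  shows "t \<in> S \<Longrightarrow> f (Suc n) t = (\<Sum>j\<le>n. of_nat (n choose j) * (D (Suc j) t * f (n - j) t))"
proof -
  have D_Suc: "D (Suc n) t = vector_derivative (D n) (at t)" for n t
    by (simp add: D_def)
  \<comment> \<open>The operator \<open>vector_derivative\<close> is total and returns an
    unspecified value where no derivative exists. Differentiability of the iterates is therefore
    carried through the induction together with the recursion.\<close>
  have "(\<forall>t\<in>S. \<forall>j\<le>n. (D j has_vector_derivative D (Suc j) t) (at t))
      \<and> (\<forall>t\<in>S. f (Suc n) t = (\<Sum>j\<le>n. of_nat (n choose j) * (D (Suc j) t * f (n - j) t)))"
  proof (induction n)
    case 0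
    have "D 0 = L" by (simp add: D_def)
    moreover have "D (Suc 0) t = f 1 t / f 0 t" if "t \<in> S" for t
      unfolding D_Suc \<open>D 0 = L\<close> by (rule vector_derivative_at[OF L[OF that]])
    ultimately show ?case using L nz by simp
  next
    case (Suc n)
    then have D: "\<And>t j. t \<in> S \<Longrightarrow> j \<le> n \<Longrightarrow> (D j has_vector_derivative D (Suc j) t) (at t)"
      and rec: "\<And>t. t \<in> S \<Longrightarrow> f (Suc n) t = (\<Sum>j\<le>n. of_nat (n choose j) * (D (Suc j) t * f (n - j) t))"
      by auto
    have D': "(D (Suc n) has_vector_derivative D (Suc (Suc n)) t) (at t)" if "t \<in> S" for t
    proof -
      \<comment> \<open>Solving the recursion for its top term expresses \<open>D (n + 1)\<close> by functions already known to be differentiable.\<close>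
      let ?R = "\<lambda>t. (f (Suc n) t - (\<Sum>j<n. of_nat (n choose j) * (D (Suc j) t * f (n - j) t))) / f 0 t"
      have R: "?R t = D (Suc n) t" if "t \<in> S" for t
        using nz[OF that] unfolding rec[OF that] by (simp add: lessThan_Suc_atMost[symmetric])
      have "f m differentiable (at t)" for m
        using f by (auto simp: differentiable_def has_vector_derivative_def)
      moreover have "D (Suc j) differentiable (at t)" if "j < n" for j
        using D[OF \<open>t \<in> S\<close>, of "Suc j"] that by (auto simp: differentiable_def has_vector_derivative_def)
      ultimately have "?R differentiable (at t)"
        using nz[OF \<open>t \<in> S\<close>]
        by (intro differentiable_divide differentiable_diff differentiable_sum differentiable_mult) auto
      then have "(?R has_vector_derivative vector_derivative ?R (at t)) (at t)"
        by (simp add: vector_derivative_works)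
      then have "(D (Suc n) has_vector_derivative vector_derivative ?R (at t)) (at t)"
        by (rule has_vector_derivative_transform_within_open[OF _ \<open>open S\<close> \<open>t \<in> S\<close> R])
      then show ?thesis
        using D_Suc[of "Suc n" t] by (simp add: vector_derivative_at)
    qed
    have D'': "(D j has_vector_derivative D (Suc j) t) (at t)" if "t \<in> S" "j \<le> Suc n" for t j
      using D[OF \<open>t \<in> S\<close>, of j] D'[OF \<open>t \<in> S\<close>] that by (auto simp: le_Suc_eq)
    have "f (Suc (Suc n)) t = (\<Sum>j\<le>Suc n. of_nat (Suc n choose j) * (D (Suc j) t * f (Suc n - j) t))"
      if "t \<in> S" for t
    proof -
      have "((\<lambda>t. \<Sum>j\<le>n. of_nat (n choose j) * (D (Suc j) t * f (n - j) t)) has_vector_derivative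
          (\<Sum>j\<le>n. of_nat (n choose j) * (D (Suc j) t * f (Suc (n - j)) t + D (Suc (Suc j)) t * f (n - j) t))) (at t)"
        by (intro has_vector_derivative_sum has_vector_derivative_mult_right has_vector_derivative_mult
            D''[OF \<open>t \<in> S\<close>] f) auto
      then have "(f (Suc n) has_vector_derivative
          (\<Sum>j\<le>n. of_nat (n choose j) * (D (Suc j) t * f (Suc (n - j)) t + D (Suc (Suc j)) t * f (n - j) t))) (at t)"
        by (rule has_vector_derivative_transform_within_open[OF _ \<open>open S\<close> \<open>t \<in> S\<close>]) (simp add: rec)
      then have "f (Suc (Suc n)) t =
          (\<Sum>j\<le>n. of_nat (n choose j) * (D (Suc j) t * f (Suc (n - j)) t + D (Suc (Suc j)) t * f (n - j) t))"
        by (rule vector_derivative_unique_at[OF f])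
      also have "\<dots> = (\<Sum>j\<le>n. of_nat (n choose j) * (D (Suc j) t * f (Suc n - j) t
          + D (Suc (Suc j)) t * f (Suc n - Suc j) t))"
        by (intro sum.cong) (auto simp: Suc_diff_le)
      also have "\<dots> = (\<Sum>j\<le>Suc n. of_nat (Suc n choose j) * (D (Suc j) t * f (Suc n - j) t))"
        by (rule sum_binomial_pascal)
      finally show ?thesis .
    qed
    then show ?case using D'' by blast
  qed
  then show "t \<in> S \<Longrightarrow> f (Suc n) t = (\<Sum>j\<le>n. of_nat (n choose j) * (D (Suc j) t * f (n - j) t))"
    by blast
qed

text \<open>The Taylor bound \<open>norm (iexp x - 1 - \<i> * x) \<le> x\<^sup>2 / 2\<close> at
  \<open>x = (s - t) * N \<omega>\<close> leaves, after integration, a remainder quadratic in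
  \<open>s - t\<close> whose constant is half the absolute moment of order
  \<open>n + 2\<close>.\<close>

lemma (in prob_space) has_vector_derivative_char_moment:
  fixes N :: "'a \<Rightarrow> real"
  assumes [measurable]: "random_variable borel N" and moments: "\<And>n. integrable M (\<lambda>\<omega>. N \<omega> ^ n)"
  defines "f \<equiv> \<lambda>n t. CLINT \<omega>|M. (\<i> * N \<omega>) ^ n * iexp (t * N \<omega>)"
  shows "(f n has_vector_derivative f (Suc n) t) (at t)"
proof (rule has_vector_derivative_of_quadratic_remainder)
  fix s
  let ?F = "\<lambda>n t \<omega>. (\<i> * N \<omega>) ^ n * iexp (t * N \<omega>)"
  have abs_moments: "integrable M (\<lambda>\<omega>. \<bar>N \<omega>\<bar> ^ n)" for n
    using integrable_abs[OF moments[of n]] by (simp add: power_abs)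
  have int: "complex_integrable M (?F n t)" for n t
    by (rule Bochner_Integration.integrable_bound[OF abs_moments[of n]]) (auto simp: norm_mult norm_power)
  let ?R = "\<lambda>\<omega>. ?F n s \<omega> - ?F n t \<omega> - (s - t) *\<^sub>R ?F (Suc n) t \<omega>"
  have "norm (?R \<omega>) \<le> (s - t)\<^sup>2 / 2 * \<bar>N \<omega>\<bar> ^ (n + 2)" for \<omega>
  proof -
    define x where "x = (s - t) * N \<omega>"
    have "\<i> * of_real (s * N \<omega>) = \<i> * of_real (t * N \<omega>) + \<i> * of_real x"
      by (simp add: x_def algebra_simps)
    then have *: "iexp (s * N \<omega>) = iexp (t * N \<omega>) * iexp x"
      by (simp only: exp_add)
    have "?R \<omega> = (\<i> * N \<omega>) ^ n * iexp (t * N \<omega>) * (iexp x - 1 - \<i> * x)"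
      
      unfolding * x_def[THEN arg_cong[where f = of_real], unfolded of_real_mult] scaleR_conv_of_real power_Suc
      by (simp only: right_diff_distrib mult_ac mult_1)
    moreover have "norm (iexp x - 1 - \<i> * x) \<le> x\<^sup>2 / 2"
      using iexp_approx1[of x 1] by (simp add: power2_eq_square diff_diff_eq)
    then have "\<bar>N \<omega>\<bar> ^ n * norm (iexp x - 1 - \<i> * x) \<le> \<bar>N \<omega>\<bar> ^ n * (x\<^sup>2 / 2)"
      by (intro mult_left_mono) auto
    ultimately have "norm (?R \<omega>) \<le> \<bar>N \<omega>\<bar> ^ n * (x\<^sup>2 / 2)"
      by (simp only: norm_mult norm_power norm_exp_i_times norm_ii norm_of_real) simp
    also have "\<bar>N \<omega>\<bar> ^ n * (x\<^sup>2 / 2) = (s - t)\<^sup>2 / 2 * \<bar>N \<omega>\<bar> ^ (n + 2)"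
      unfolding power_add x_def power_mult_distrib power2_abs by simp
    finally show ?thesis .
  qed
  note R_le = this
  have int_R: "complex_integrable M ?R"
    by (intro Bochner_Integration.integrable_diff integrable_scaleR_right int)
  have "f n s - f n t - (s - t) *\<^sub>R f (Suc n) t = (CLINT \<omega>|M. ?R \<omega>)"
    unfolding f_def using int[of n s] int[of n t] int[of "Suc n" t] by (simp del: power_Suc)
  then have "norm (f n s - f n t - (s - t) *\<^sub>R f (Suc n) t) \<le> expectation (\<lambda>\<omega>. norm (?R \<omega>))"
    using integral_norm_bound[of M ?R] by (simp only:)
  also have "expectation (\<lambda>\<omega>. norm (?R \<omega>)) \<le> expectation (\<lambda>\<omega>. (s - t)\<^sup>2 / 2 * \<bar>N \<omega>\<bar> ^ (n + 2))"
    using int_R R_le by (intro integral_mono integrable_norm integrable_mult_right abs_moments)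
  also have "\<dots> = expectation (\<lambda>\<omega>. \<bar>N \<omega>\<bar> ^ (n + 2)) / 2 * (s - t)\<^sup>2"
    by (subst integral_mult_right_zero) simp
  finally show "norm (f n s - f n t - (s - t) *\<^sub>R f (Suc n) t)
      \<le> expectation (\<lambda>\<omega>. \<bar>N \<omega>\<bar> ^ (n + 2)) / 2 * (s - t)\<^sup>2" .
qed


text \<open>The recursion for the logarithm of the characteristic function is evaluated at 0, where
  the derivatives are the moments up to powers of the imaginary unit. These have modulus one and
  vanish in the triangle inequality.\<close>

lemma (in prob_space) moment_le_cumulants:
  fixes N :: "'a \<Rightarrow> real"
  assumes [measurable]: "random_variable borel N" and moments: "\<And>n. integrable M (\<lambda>\<omega>. N \<omega> ^ n)"
  shows "\<bar>expectation (\<lambda>\<omega>. N \<omega> ^ Suc n)\<bar>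
      \<le> (\<Sum>j\<le>n. real (n choose j) * (cmod (cumulant M N (Suc j)) * \<bar>expectation (\<lambda>\<omega>. N \<omega> ^ (n - j))\<bar>))"
proof -
  define f where "f = (\<lambda>n t. CLINT \<omega>|M. (\<i> * N \<omega>) ^ n * iexp (t * N \<omega>))"
  define L where "L = (\<lambda>t::real. Ln (char (distr M borel N) t))"
  define D where "D = (\<lambda>n. ((\<lambda>g t. vector_derivative g (at t)) ^^ n) L)"
  have f: "(f n has_vector_derivative f (Suc n) t) (at t)" for n t
    unfolding f_def using assms by (rule has_vector_derivative_char_moment)
  have char: "char (distr M borel N) t = f 0 t" for t
    unfolding f_def char_def by (subst integral_distr) auto
  \<comment> \<open>On this set the characteristic function avoids the branch cut of
    \<open>Ln\<close>. It is open by continuity and contains 0, where the characteristic function is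
    1.\<close>
  define S where "S = {t. 0 < Re (f 0 t)}"
  have "continuous_on UNIV (f 0)"
    using f by (intro continuous_at_imp_continuous_on ballI has_vector_derivative_continuous)
  then have "open S" unfolding S_def
    by (intro open_Collect_less continuous_intros) auto
  have S_not_nonpos: "f 0 t \<notin> \<real>\<^sub>\<le>\<^sub>0" if "t \<in> S" for t
    using that by (auto simp: S_def complex_nonpos_Reals_iff)
  have L: "(L has_vector_derivative f 1 t / f 0 t) (at t)" if "t \<in> S" for t
    using field_vector_diff_chain_at[OF f[of 0] has_field_derivative_Ln[OF S_not_nonpos[OF that]]]
    by (simp add: L_def char o_def divide_inverse)
  have f_0: "f n 0 = \<i> ^ n * expectation (\<lambda>\<omega>. N \<omega> ^ n)" for n
    unfolding f_def by (simp add: power_mult_distrib flip: of_real_power)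
  then have "0 \<in> S"
    by (simp add: S_def prob_space)
  have "f (Suc n) 0 = (\<Sum>j\<le>n. of_nat (n choose j) * (D (Suc j) 0 * f (n - j) 0))"
    unfolding D_def
    by (rule iterated_log_derivative_recursion[OF f \<open>open S\<close> _ L \<open>0 \<in> S\<close>]) (auto simp: S_def)
  then have "cmod (f (Suc n) 0) \<le> (\<Sum>j\<le>n. cmod (of_nat (n choose j) * (D (Suc j) 0 * f (n - j) 0)))"
    by (metis norm_sum)
  moreover have "cmod (cumulant M N j) = cmod (D j 0)" for j
    unfolding cumulant_def D_def L_def by (simp add: norm_mult norm_power)
  ultimately show ?thesis
    by (simp add: f_0 norm_mult norm_power del: power_Suc)
qed

section \<open>A majorant for generating functions with a convolution recursion\<close>

text \<open>The recursion amounts to the differential inequality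
  \<open>B' x \<le> \<mu> / (1 - K * x)\<^sup>2 * B x\<close> for the generating polynomial
  \<open>B\<close>, and Gronwall's argument bounds \<open>B\<close>. Truncation makes
  differentiation elementary, while the bound does not depend on the degree
  \<open>N\<close>.\<close>

lemma sum_power_le_exp_of_recursion:
  fixes b :: "nat \<Rightarrow> real" and K \<mu> z :: real
  assumes b: "b 0 = 1" "\<And>n. 0 \<le> b n" and "0 \<le> K" "0 \<le> \<mu>"
    and rec: "\<And>n. Suc n * b (Suc n) \<le> (\<Sum>j\<le>n. Suc j * K ^ j * \<mu> * b (n - j))"
    and z: "0 \<le> z" "K * z < 1"
  shows "(\<Sum>n\<le>N. b n * z ^ n) \<le> exp (\<mu> * z / (1 - K * z))"
proof -
  define B where "B x = (\<Sum>n\<le>N. b n * x ^ n)" for x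
  define B' where "B' x = (\<Sum>n<N. Suc n * b (Suc n) * x ^ n)" for x
  have B': "(B has_real_derivative B' x) (at x)" for x
  proof -
    have "(B has_real_derivative (\<Sum>n\<le>N. b n * (n * x ^ (n - 1)))) (at x)"
      unfolding B_def by (intro DERIV_sum DERIV_cmult DERIV_pow[THEN DERIV_cong]) simp
    also have "(\<Sum>n\<le>N. b n * (n * x ^ (n - 1))) = B' x"
      unfolding B'_def by (subst sum.atMost_shift) (simp add: mult_ac)
    finally show ?thesis .
  qed
  have B'_le: "B' x \<le> \<mu> / (1 - K * x)\<^sup>2 * B x" if x: "0 \<le> x" "K * x < 1" for x
  proof -
    define c where "c j = Suc j * (K * x) ^ j * \<mu>" for j
    define d where "d i = b i * x ^ i" for i
    have nonneg: "0 \<le> c j" "0 \<le> d i" for i j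
      using assms x by (auto simp: c_def d_def)
    \<comment> \<open>The Cauchy product of the series of \<open>\<mu> / (1 - K x)\<^sup>2\<close> with \<open>B\<close>, truncated at degree \<open>N\<close>.\<close>
    have "B' x \<le> (\<Sum>n<N. \<Sum>j\<le>n. c j * d (n - j))"
      unfolding B'_def
    proof (rule sum_mono)
      fix n
      have "Suc n * b (Suc n) * x ^ n \<le> (\<Sum>j\<le>n. Suc j * K ^ j * \<mu> * b (n - j)) * x ^ n"
        using rec[of n] x by (intro mult_right_mono) auto
      also have "\<dots> = (\<Sum>j\<le>n. c j * d (n - j))"
        unfolding sum_distrib_right c_def d_def
      proof (rule sum.cong)
        fix j assume "j \<in> {..n}"
        then have "x ^ n = x ^ j * x ^ (n - j)" by (simp flip: power_add)
        then show "Suc j * K ^ j * \<mu> * b (n - j) * x ^ n = Suc j * (K * x) ^ j * \<mu> * (b (n - j) * x ^ (n - j))"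
          by (simp only: power_mult_distrib mult_ac)
      qed simp
      finally show "Suc n * b (Suc n) * x ^ n \<le> (\<Sum>j\<le>n. c j * d (n - j))" .
    qed
    also have "\<dots> = (\<Sum>(j, i)\<in>{(j, i). j + i < N}. c j * d i)"
      by (simp add: sum.triangle_reindex)
    also have "\<dots> \<le> (\<Sum>(j, i)\<in>{..<N} \<times> {..N}. c j * d i)"
      using nonneg by (intro sum_mono2) auto
    also have "\<dots> = (\<Sum>j<N. c j) * B x"
      by (simp add: B_def d_def sum_product sum.cartesian_product)
    also have "\<dots> \<le> \<mu> / (1 - K * x)\<^sup>2 * B x"
    proof (rule mult_right_mono)
      have "norm (K * x) < 1" using x \<open>0 \<le> K\<close> by simp
      from sums_mult[OF geometric_deriv_sums[OF this], of \<mu>]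
      have "c sums (\<mu> / (1 - K * x)\<^sup>2)"
        by (simp add: c_def[abs_def] mult_ac)
      then show "(\<Sum>j<N. c j) \<le> \<mu> / (1 - K * x)\<^sup>2"
        using nonneg by (metis finite_lessThan sum_le_suminf sums_iff)
      show "0 \<le> B x" using nonneg by (auto simp: B_def d_def intro: sum_nonneg)
    qed
    finally show ?thesis .
  qed
  \<comment> \<open>This is the antiderivative of \<open>\<mu> / (1 - K * x)\<^sup>2\<close> that
    vanishes at 0, so \<open>exp (- g x)\<close> is the integrating factor.\<close>
  define g where "g x = \<mu> * x / (1 - K * x)" for x
  have "B z * exp (- g z) \<le> B 0 * exp (- g 0)"
  proof (rule DERIV_nonpos_imp_nonincreasing[OF z(1)])
    fix x assume x: "0 \<le> x" "x \<le> z"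
    then have Kx: "K * x < 1"
      using z \<open>0 \<le> K\<close> mult_left_mono[of x z K] by linarith
    have "(g has_real_derivative \<mu> / (1 - K * x)\<^sup>2) (at x)"
      unfolding g_def using Kx
      by (auto intro!: derivative_eq_intros simp: power2_eq_square field_simps)
    then have "((\<lambda>x. B x * exp (- g x)) has_real_derivative
        (B' x - \<mu> / (1 - K * x)\<^sup>2 * B x) * exp (- g x)) (at x)"
      by (auto intro!: derivative_eq_intros B' simp: algebra_simps)
    moreover have "(B' x - \<mu> / (1 - K * x)\<^sup>2 * B x) * exp (- g x) \<le> 0"
      using B'_le[OF x(1) Kx] by (intro mult_nonpos_nonneg) auto
    ultimately show "\<exists>y. ((\<lambda>x. B x * exp (- g x)) has_real_derivative y) (at x) \<and> y \<le> 0"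
      by blast
  qed
  moreover have "B 0 = 1" unfolding B_def using b(1) by (simp add: power_0_left sum.If_cases if_distrib cong: if_cong)
  ultimately show ?thesis
    by (simp add: B_def g_def exp_minus field_simps)
qed

section \<open>Moment generating functions\<close>

lemma exp_abs_le_cosh: "exp \<bar>x\<bar> \<le> 2 * cosh (x::real)"
  by (cases "0 \<le> x") (auto simp: cosh_def)

lemma (in prob_space) mgf_of_summable_moments:
  fixes X :: "'a \<Rightarrow> real"
  assumes [measurable]: "random_variable borel X" and moments: "\<And>n. integrable M (\<lambda>\<omega>. X \<omega> ^ n)"
    and summable: "summable (\<lambda>n. \<bar>s\<bar> ^ n * \<bar>expectation (\<lambda>\<omega>. X \<omega> ^ n)\<bar> / fact n)"
  shows integrable_exp_of_summable_moments: "integrable M (\<lambda>\<omega>. exp (s * X \<omega>))"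
    and mgf_sums_of_summable_moments:
      "(\<lambda>n. s ^ n * expectation (\<lambda>\<omega>. X \<omega> ^ n) / fact n) sums expectation (\<lambda>\<omega>. exp (s * X \<omega>))"
proof -
  \<comment> \<open>The series of \<open>cosh\<close> has nonnegative terms, so that signed moments suffice for its integrability.\<close>
  define f where "f n \<omega> = (if even n then (s * X \<omega>) ^ n /\<^sub>R fact n else 0)" for n \<omega>
  have f_sums: "(\<lambda>n. f n \<omega>) sums cosh (s * X \<omega>)" for \<omega>
    unfolding f_def by (rule cosh_converges)
  have norm_f: "norm (f n \<omega>) = f n \<omega>" for n \<omega>
    unfolding f_def by (auto intro!: mult_nonneg_nonneg zero_le_even_power)
  have int_f: "integrable M (f n)" for n
    unfolding f_def[abs_def] using moments[of n]
    by (cases "even n") (simp_all add: power_mult_distrib)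
  have "integrable M (\<lambda>\<omega>. \<Sum>n. f n \<omega>)"
  proof (rule integrable_suminf[OF int_f])
    show "AE \<omega> in M. summable (\<lambda>n. norm (f n \<omega>))"
      unfolding norm_f using f_sums sums_summable by blast
    have "norm (expectation (f n)) \<le> \<bar>s\<bar> ^ n * \<bar>expectation (\<lambda>\<omega>. X \<omega> ^ n)\<bar> / fact n" for n
      by (cases "even n") (auto simp: f_def[abs_def] power_mult_distrib abs_mult power_abs divide_inverse mult_ac)
    then show "summable (\<lambda>n. expectation (\<lambda>\<omega>. norm (f n \<omega>)))"
      unfolding norm_f by (intro summable_comparison_test'[OF summable]) auto
  qed
  then have int_cosh: "integrable M (\<lambda>\<omega>. 2 * cosh (s * X \<omega>))"
    using f_sums by (simp add: sums_iff)
  have "norm (exp (s * X \<omega>)) \<le> norm (2 * cosh (s * X \<omega>))" for \<omega>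
    using order_trans[OF exp_le_cancel_iff[THEN iffD2, OF abs_ge_self] exp_abs_le_cosh, of "s * X \<omega>"] by simp
  then show "integrable M (\<lambda>\<omega>. exp (s * X \<omega>))"
    by (intro Bochner_Integration.integrable_bound[OF int_cosh]) auto
  \<comment> \<open>All partial sums of the exponential series are dominated by
    \<open>exp \<bar>x\<bar> \<le> 2 * cosh x\<close>, so the integrable \<open>cosh\<close> also
    justifies the termwise expectation.\<close>
  have "(\<lambda>N. expectation (\<lambda>\<omega>. \<Sum>n<N. (s * X \<omega>) ^ n /\<^sub>R fact n)) \<longlonglongrightarrow> expectation (\<lambda>\<omega>. exp (s * X \<omega>))"
  proof (rule integral_dominated_convergence[OF _ _ int_cosh])
    show "AE \<omega> in M. (\<lambda>N. \<Sum>n<N. (s * X \<omega>) ^ n /\<^sub>R fact n) \<longlonglongrightarrow> exp (s * X \<omega>)"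
      using exp_converges unfolding sums_def by (intro AE_I2) blast
    fix N
    have "norm (\<Sum>n<N. x ^ n /\<^sub>R fact n) \<le> 2 * cosh x" for x :: real
    proof -
      have "norm (\<Sum>n<N. x ^ n /\<^sub>R fact n) \<le> (\<Sum>n<N. \<bar>x\<bar> ^ n /\<^sub>R fact n)"
        by (rule order_trans[OF norm_sum]) (simp add: abs_mult power_abs)
      also have "\<dots> \<le> exp \<bar>x\<bar>"
        unfolding sums_unique[OF exp_converges[of "\<bar>x\<bar>"]]
        by (intro sum_le_suminf sums_summable[OF exp_converges]) auto
      finally show ?thesis using exp_abs_le_cosh[of x] by linarith
    qed
    then show "AE \<omega> in M. norm (\<Sum>n<N. (s * X \<omega>) ^ n /\<^sub>R fact n) \<le> 2 * cosh (s * X \<omega>)"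
      by simp
  qed measurable
  moreover have "expectation (\<lambda>\<omega>. \<Sum>n<N. (s * X \<omega>) ^ n /\<^sub>R fact n)
      = (\<Sum>n<N. s ^ n * expectation (\<lambda>\<omega>. X \<omega> ^ n) / fact n)" for N
    using moments by (simp add: power_mult_distrib divide_inverse mult_ac)
  ultimately show "(\<lambda>n. s ^ n * expectation (\<lambda>\<omega>. X \<omega> ^ n) / fact n) sums expectation (\<lambda>\<omega>. exp (s * X \<omega>))"
    by (simp add: sums_def)
qed

text \<open>The first three moments produce \<open>1 + s\<^sup>2 / 2\<close>. From degree 3 on, the
  factorials cancel and the terms are dominated by a geometric series with ratio
  \<open>K * \<bar>s\<bar>\<close>; the exponent \<open>n - 2\<close> in the bound leaves the factor
  \<open>s\<^sup>2\<close> in front.\<close>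

lemma (in prob_space) mgf_quadratic_expansion:
  fixes X :: "'a \<Rightarrow> real"
  assumes X: "random_variable borel X" and moments: "\<And>n. integrable M (\<lambda>\<omega>. X \<omega> ^ n)"
    and "expectation X = 0" "expectation (\<lambda>\<omega>. X \<omega> ^ 2) = 1"
    and bound: "\<And>n. n \<ge> 3 \<Longrightarrow> \<bar>expectation (\<lambda>\<omega>. X \<omega> ^ n)\<bar> \<le> fact n * K ^ (n - 2)"
    and "0 \<le> K" and s: "K * \<bar>s\<bar> < 1"
  shows "integrable M (\<lambda>\<omega>. exp (s * X \<omega>))"
    and "\<bar>expectation (\<lambda>\<omega>. exp (s * X \<omega>)) - 1 - s\<^sup>2 / 2\<bar> \<le> s\<^sup>2 * (K * \<bar>s\<bar> / (1 - K * \<bar>s\<bar>))"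
proof -
  define m where "m n = expectation (\<lambda>\<omega>. X \<omega> ^ n)" for n
  have "norm (K * \<bar>s\<bar>) < 1" using s \<open>0 \<le> K\<close> by simp
  from sums_mult[OF geometric_sums[OF this], of "s\<^sup>2 * (K * \<bar>s\<bar>)"]
  have geom: "(\<lambda>n. s\<^sup>2 * (K * \<bar>s\<bar>) * (K * \<bar>s\<bar>) ^ n) sums (s\<^sup>2 * (K * \<bar>s\<bar> / (1 - K * \<bar>s\<bar>)))"
    by simp
  have tail: "\<bar>s\<bar> ^ (n + 3) * \<bar>m (n + 3)\<bar> / fact (n + 3) \<le> s\<^sup>2 * (K * \<bar>s\<bar>) * (K * \<bar>s\<bar>) ^ n" for n
  proof -
    have "\<bar>m (n + 3)\<bar> / fact (n + 3) \<le> K ^ (n + 1)"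
      using bound[of "n + 3"] unfolding m_def by (simp add: divide_le_eq mult.commute del: fact_Suc)
    then have "\<bar>s\<bar> ^ (n + 3) * (\<bar>m (n + 3)\<bar> / fact (n + 3)) \<le> \<bar>s\<bar> ^ (n + 3) * K ^ (n + 1)"
      by (rule mult_left_mono) simp
    also have "\<dots> = \<bar>s\<bar>\<^sup>2 * (K * \<bar>s\<bar>) * (K * \<bar>s\<bar>) ^ n"
      by (simp only: power_mult_distrib power_add mult_ac power2_eq_square power3_eq_cube power_one_right)
    finally show ?thesis by simp
  qed
  have "summable (\<lambda>n. \<bar>s\<bar> ^ (n + 3) * \<bar>m (n + 3)\<bar> / fact (n + 3))"
    using tail by (intro summable_comparison_test'[OF sums_summable[OF geom]]) auto
  then have summable: "summable (\<lambda>n. \<bar>s\<bar> ^ n * \<bar>m n\<bar> / fact n)"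
    by (rule summable_iff_shift[THEN iffD1])
  show "integrable M (\<lambda>\<omega>. exp (s * X \<omega>))"
    using X moments summable unfolding m_def by (rule integrable_exp_of_summable_moments)
  have "(\<lambda>n. s ^ n * m n / fact n) sums expectation (\<lambda>\<omega>. exp (s * X \<omega>))"
    using X moments summable unfolding m_def by (rule mgf_sums_of_summable_moments)
  from sums_split_initial_segment[OF this, of 3]
  have "(\<lambda>n. s ^ (n + 3) * m (n + 3) / fact (n + 3)) sums (expectation (\<lambda>\<omega>. exp (s * X \<omega>)) - 1 - s\<^sup>2 / 2)"
    using assms(3,4) by (simp add: m_def numeral_3_eq_3 prob_space power2_eq_square diff_diff_eq)
  moreover have "norm (\<Sum>n. s ^ (n + 3) * m (n + 3) / fact (n + 3)) \<le> (\<Sum>n. s\<^sup>2 * (K * \<bar>s\<bar>) * (K * \<bar>s\<bar>) ^ n)"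
    using tail by (intro norm_suminf_le sums_summable[OF geom]) (simp add: abs_mult power_abs)
  ultimately show "\<bar>expectation (\<lambda>\<omega>. exp (s * X \<omega>)) - 1 - s\<^sup>2 / 2\<bar> \<le> s\<^sup>2 * (K * \<bar>s\<bar> / (1 - K * \<bar>s\<bar>))"
    by (simp add: sums_unique[OF geom, symmetric] sums_iff)
qed

text \<open>The hypothesis gives the limit of \<open>(\<phi> s - 1) / s\<^sup>2\<close>, and
  \<open>(\<phi> s - 1) / \<phi> s \<le> ln (\<phi> s) \<le> \<phi> s - 1\<close> transfers it to
  the logarithm because \<open>\<phi>\<close> tends to 1.\<close>

lemma tendsto_ln_over_square:
  fixes \<phi> :: "real \<Rightarrow> real"
  assumes "0 \<le> K"
    and \<phi>: "\<And>s. K * \<bar>s\<bar> < 1 \<Longrightarrow> \<bar>\<phi> s - 1 - s\<^sup>2 / 2\<bar> \<le> s\<^sup>2 * (K * \<bar>s\<bar> / (1 - K * \<bar>s\<bar>))"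
  shows "((\<lambda>s. ln (\<phi> s) / s\<^sup>2) \<longlongrightarrow> 1 / 2) (at 0)"
proof -
  define q where "q s = (\<phi> s - 1) / s\<^sup>2" for s
  have "((\<lambda>s. K * \<bar>s\<bar>) \<longlongrightarrow> K * \<bar>0\<bar>) (at 0)"
    by (intro tendsto_intros)
  then have small: "\<forall>\<^sub>F s in at 0. K * \<bar>s\<bar> < 1"
    by (rule order_tendstoD) simp
  have nz: "\<forall>\<^sub>F s in at 0. s \<noteq> (0::real)"
    by (simp add: eventually_at_filter)
  have "((\<lambda>s. K * \<bar>s\<bar> / (1 - K * \<bar>s\<bar>)) \<longlongrightarrow> K * \<bar>0\<bar> / (1 - K * \<bar>0\<bar>)) (at 0)"
    by (intro tendsto_intros) auto
  then have lim0: "((\<lambda>s. K * \<bar>s\<bar> / (1 - K * \<bar>s\<bar>)) \<longlongrightarrow> 0) (at 0)"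
    by simp
  have "((\<lambda>s. q s - 1 / 2) \<longlongrightarrow> 0) (at 0)"
  proof (rule Lim_null_comparison[OF _ lim0])
    show "\<forall>\<^sub>F s in at 0. norm (q s - 1 / 2) \<le> K * \<bar>s\<bar> / (1 - K * \<bar>s\<bar>)"
      using small nz
    proof eventually_elim
      case (elim s)
      then have "q s - 1 / 2 = (\<phi> s - 1 - s\<^sup>2 / 2) / s\<^sup>2"
        by (simp add: q_def diff_divide_distrib)
      then have "\<bar>q s - 1 / 2\<bar> = \<bar>\<phi> s - 1 - s\<^sup>2 / 2\<bar> / s\<^sup>2"
        by simp
      also have "\<dots> \<le> K * \<bar>s\<bar> / (1 - K * \<bar>s\<bar>)"
        using \<phi>[OF elim(1)] elim(2) by (subst pos_divide_le_eq) (auto simp: mult.commute)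
      finally show ?case by simp
    qed
  qed
  then have q: "(q \<longlongrightarrow> 1 / 2) (at 0)"
    by (rule LIM_zero_cancel)
  have "((\<lambda>s. 1 + s\<^sup>2 * q s) \<longlongrightarrow> 1 + 0\<^sup>2 * (1 / 2)) (at 0)"
    by (intro tendsto_intros q)
  moreover have "\<forall>\<^sub>F s in at 0. 1 + s\<^sup>2 * q s = \<phi> s"
    using nz by eventually_elim (simp add: q_def)
  ultimately have \<phi>_1: "(\<phi> \<longlongrightarrow> 1) (at 0)"
    using Lim_transform_eventually by fastforce
  have \<phi>_pos: "\<forall>\<^sub>F s in at 0. 0 < \<phi> s"
    by (rule order_tendstoD[OF \<phi>_1]) simp
  show ?thesis
  proof (rule tendsto_sandwich)
    have "((\<lambda>s. q s / \<phi> s) \<longlongrightarrow> (1 / 2) / 1) (at 0)"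
      by (intro tendsto_intros q \<phi>_1) simp
    then show "((\<lambda>s. q s / \<phi> s) \<longlongrightarrow> 1 / 2) (at 0)"
      by simp
    show "(q \<longlongrightarrow> 1 / 2) (at 0)" by (rule q)
    show "\<forall>\<^sub>F s in at 0. ln (\<phi> s) / s\<^sup>2 \<le> q s"
      using \<phi>_pos
    proof eventually_elim
      case (elim s)
      show ?case unfolding q_def by (intro divide_right_mono ln_le_minus_one elim) auto
    qed
    show "\<forall>\<^sub>F s in at 0. q s / \<phi> s \<le> ln (\<phi> s) / s\<^sup>2"
      using \<phi>_pos
    proof eventually_elim
      case (elim s)
      have "(\<phi> s - 1) / \<phi> s \<le> ln (\<phi> s)"
        using ln_le_minus_one[of "1 / \<phi> s"] elim by (simp add: ln_div diff_divide_distrib)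
      then have "(\<phi> s - 1) / \<phi> s / s\<^sup>2 \<le> ln (\<phi> s) / s\<^sup>2"
        by (rule divide_right_mono) simp
      then show ?case by (simp add: q_def mult.commute)
    qed
  qed
qed

section \<open>Independence and the transform of a random sum\<close>

lemma sigma_sets_compose_subset_vimage_algebra:
  assumes [measurable]: "Z \<in> measurable M N" "h \<in> borel_measurable N"
  shows "sigma_sets (space M) {(\<lambda>\<omega>. h (Z \<omega>)) -` A \<inter> space M |A. A \<in> sets borel}
      \<subseteq> sets (vimage_algebra (space M) Z N)"
proof -
  have "(\<lambda>\<omega>. h (Z \<omega>)) -` A \<inter> space M \<in> sets (vimage_algebra (space M) Z N)" if "A \<in> sets borel" for A
  proof -
    have "(\<lambda>\<omega>. h (Z \<omega>)) -` A \<inter> space M = Z -` (h -` A \<inter> space N) \<inter> space M"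
      using measurable_space[OF assms(1)] by auto
    also have "\<dots> \<in> sets (vimage_algebra (space M) Z N)"
      using assms(2) that by (intro in_vimage_algebra measurable_sets)
    finally show ?thesis .
  qed
  then have "{(\<lambda>\<omega>. h (Z \<omega>)) -` A \<inter> space M |A. A \<in> sets borel} \<subseteq> sets (vimage_algebra (space M) Z N)"
    by auto
  from sets.sigma_sets_subset[OF this] show ?thesis by simp
qed

lemma (in prob_space) indep_set_mono:
  assumes "indep_set A B" "A' \<subseteq> A" "B' \<subseteq> B"
  shows "indep_set A' B'"
  using assms unfolding indep_sets2_eq by blast

text \<open>Borel images generate smaller sigma-algebras, so independence passes to real-valued
  functions of the two variables. For these the product rule for expectations is available.\<close>

lemma (in prob_space) indep_var_compose_indep_rvs:
  assumes "indep_rvs M S X T Y" and [measurable]: "f \<in> borel_measurable S" "g \<in> borel_measurable T"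
  shows "indep_var borel (\<lambda>\<omega>. f (X \<omega>)) borel (\<lambda>\<omega>. g (Y \<omega>))"
proof -
  have [measurable]: "X \<in> measurable M S" "Y \<in> measurable M T"
    and indep: "indep_set (sets (vimage_algebra (space M) X S)) (sets (vimage_algebra (space M) Y T))"
    using assms by (auto simp: indep_rvs_def)
  have "indep_set (sigma_sets (space M) {(\<lambda>\<omega>. f (X \<omega>)) -` A \<inter> space M |A. A \<in> sets borel})
      (sigma_sets (space M) {(\<lambda>\<omega>. g (Y \<omega>)) -` A \<inter> space M |A. A \<in> sets borel})"
    by (rule indep_set_mono[OF indep]) (rule sigma_sets_compose_subset_vimage_algebra; measurable)+
  then show ?thesis
    unfolding indep_var_eq by simp
qed

text \<open>On the event that \<open>\<nu>\<close> equals \<open>n\<close>, independence replaces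
  the exponential of the sum by its mean \<open>\<phi> ^ n = exp (z * n)\<close>. Summation over
  \<open>n\<close> turns this into the transform of \<open>\<nu>\<close> at
  \<open>z\<close>.\<close>

lemma (in prob_space) mgf_random_sum:
  fixes X :: "nat \<Rightarrow> 'a \<Rightarrow> real" and \<nu> :: "'a \<Rightarrow> nat"
  assumes indep_X: "indep_vars (\<lambda>_. borel) X {1..}"
    and ident: "\<And>i. i \<ge> 1 \<Longrightarrow> distr M borel (X i) = distr M borel (X 1)"
    and indep: "indep_rvs M (count_space UNIV) \<nu> (Pi\<^sub>M {1..} (\<lambda>_. borel)) (\<lambda>\<omega>. \<lambda>i\<in>{1..}. X i \<omega>)"
    and int_X: "integrable M (\<lambda>\<omega>. exp (s * X 1 \<omega>))"
  defines "z \<equiv> ln (expectation (\<lambda>\<omega>. exp (s * X 1 \<omega>)))"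
  assumes int_\<nu>: "integrable M (\<lambda>\<omega>. exp (z * real (\<nu> \<omega>)))"
  shows "integrable M (\<lambda>\<omega>. exp (s * (\<Sum>i=1..\<nu> \<omega>. X i \<omega>)))"
    and "expectation (\<lambda>\<omega>. exp (s * (\<Sum>i=1..\<nu> \<omega>. X i \<omega>))) = expectation (\<lambda>\<omega>. exp (z * real (\<nu> \<omega>)))"
proof -
  have X [measurable]: "random_variable borel (X i)" if "i \<ge> 1" for i
    using indep_X that by (auto simp: indep_vars_def)
  have \<nu> [measurable]: "\<nu> \<in> measurable M (count_space UNIV)"
    using indep by (simp add: indep_rvs_def)
  define \<phi> where "\<phi> = expectation (\<lambda>\<omega>. exp (s * X 1 \<omega>))"
  have "0 < \<phi>"
    unfolding \<phi>_def using int_X by (intro expectation_greater) auto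
  then have exp_z: "exp (z * real n) = \<phi> ^ n" for n
    unfolding z_def \<phi>_def[symmetric] exp_of_nat2_mult by simp
  define S where "S n \<omega> = exp (s * (\<Sum>i=1..n. X i \<omega>))" for n \<omega>
  have S_nonneg: "0 \<le> S n \<omega>" for n \<omega>
    by (simp add: S_def)
  have S_meas [measurable]: "S n \<in> borel_measurable M" for n
    unfolding S_def[abs_def] using X by (intro borel_measurable_exp[THEN measurable_compose[rotated]]) simp
  have int_i: "integrable M (\<lambda>\<omega>. exp (s * X i \<omega>))"
    and exp_i: "expectation (\<lambda>\<omega>. exp (s * X i \<omega>)) = \<phi>" if "i \<ge> 1" for i
  proof -
    have 1: "integrable (distr M borel (X i)) (\<lambda>x. exp (s * x)) \<longleftrightarrow> integrable M (\<lambda>\<omega>. exp (s * X i \<omega>))"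
      and 2: "(\<integral>x. exp (s * x) \<partial>distr M borel (X i)) = expectation (\<lambda>\<omega>. exp (s * X i \<omega>))"
      if "i \<ge> 1" for i
      using X[OF that] by (auto simp: integrable_distr_eq integral_distr)
    show "integrable M (\<lambda>\<omega>. exp (s * X i \<omega>))"
      using 1[OF that] 1[of 1] ident[OF that] int_X by simp
    show "expectation (\<lambda>\<omega>. exp (s * X i \<omega>)) = \<phi>"
      using 2[OF that] 2[of 1] ident[OF that] by (simp add: \<phi>_def)
  qed
  have S_prod: "S n \<omega> = (\<Prod>i=1..n. exp (s * X i \<omega>))" for n \<omega>
    by (simp add: S_def sum_distrib_left exp_sum)
  have indep_exp: "indep_vars (\<lambda>_. borel) (\<lambda>i \<omega>. exp (s * X i \<omega>)) {1..n}" for n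
    by (rule indep_vars_compose2[OF indep_vars_subset[OF indep_X], where Y = "\<lambda>_ x. exp (s * x)"]) auto
  have int_S: "integrable M (S n)" and exp_S: "expectation (S n) = \<phi> ^ n" for n
  proof -
    show "integrable M (S n)"
      unfolding S_prod[abs_def] using indep_exp int_i by (intro indep_vars_integrable) auto
    show "expectation (S n) = \<phi> ^ n"
      unfolding S_prod[abs_def] using indep_exp[of n] int_i exp_i
      by (subst indep_vars_lebesgue_integral) auto
  qed
  define p where "p n = expectation (\<lambda>\<omega>. of_bool (\<nu> \<omega> = n) :: real)" for n
  have int_of_bool: "integrable M (\<lambda>\<omega>. of_bool (\<nu> \<omega> = n) :: real)" for n
    by (rule integrable_const_bound[where B = 1]) auto
  have S_indep: "indep_var borel (\<lambda>\<omega>. of_bool (\<nu> \<omega> = n) :: real) borel (S n)" for n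
  proof -
    have meas: "(\<lambda>y. exp (s * (\<Sum>i=1..n. y i))) \<in> borel_measurable (Pi\<^sub>M {1..} (\<lambda>_. borel :: real measure))"
      by (intro measurable_compose[OF _ borel_measurable_exp] borel_measurable_times
          borel_measurable_sum measurable_component_singleton) auto
    have "(\<lambda>\<omega>. exp (s * (\<Sum>i=1..n. (\<lambda>i\<in>{1..}. X i \<omega>) i))) = S n"
      by (auto simp: S_def fun_eq_iff)
    with indep_var_compose_indep_rvs[OF indep, of "\<lambda>k. of_bool (k = n) :: real", OF _ meas]
    show ?thesis by simp
  qed
  \<comment> \<open>Nonnegative integrals allow the series over the values of \<open>\<nu>\<close>
    to be exchanged with the integral before integrability of the random sum is known. The identity
    is used twice, with \<open>g n = S n\<close> and with the constant \<open>exp (z * n)\<close>,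
    so both integrals equal the same series.\<close>
  have split_nn: "(\<integral>\<^sup>+\<omega>. ennreal (g (\<nu> \<omega>) \<omega>) \<partial>M) = (\<Sum>n. ennreal (p n * \<phi> ^ n))"
    if g: "\<And>n. integrable M (\<lambda>\<omega>. of_bool (\<nu> \<omega> = n) * g n \<omega>)"
      "\<And>n. expectation (\<lambda>\<omega>. of_bool (\<nu> \<omega> = n) * g n \<omega>) = p n * \<phi> ^ n"
      and nonneg: "\<And>n \<omega>. 0 \<le> g n \<omega>"
    for g :: "nat \<Rightarrow> 'a \<Rightarrow> real"
  proof -
    have "ennreal (g (\<nu> \<omega>) \<omega>) = (\<Sum>n. ennreal (of_bool (\<nu> \<omega> = n) * g n \<omega>))" for \<omega>
    proof -
      have "(\<Sum>n. ennreal (of_bool (\<nu> \<omega> = n) * g n \<omega>)) = (\<Sum>n\<in>{\<nu> \<omega>}. ennreal (of_bool (\<nu> \<omega> = n) * g n \<omega>))"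
        by (intro suminf_finite) auto
      then show ?thesis by simp
    qed
    then have "(\<integral>\<^sup>+\<omega>. ennreal (g (\<nu> \<omega>) \<omega>) \<partial>M) = (\<integral>\<^sup>+\<omega>. (\<Sum>n. ennreal (of_bool (\<nu> \<omega> = n) * g n \<omega>)) \<partial>M)"
      by simp
    also have "\<dots> = (\<Sum>n. \<integral>\<^sup>+\<omega>. ennreal (of_bool (\<nu> \<omega> = n) * g n \<omega>) \<partial>M)"
      using g(1) by (intro nn_integral_suminf) (auto dest: borel_measurable_integrable)
    also have "\<dots> = (\<Sum>n. ennreal (p n * \<phi> ^ n))"
      using g nonneg by (subst nn_integral_eq_integral) auto
    finally show ?thesis .
  qed
  have "(\<integral>\<^sup>+\<omega>. ennreal (S (\<nu> \<omega>) \<omega>) \<partial>M) = (\<Sum>n. ennreal (p n * \<phi> ^ n))"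
    using indep_var_integrable[OF S_indep int_of_bool int_S] indep_var_lebesgue_integral[OF S_indep int_of_bool int_S]
    by (intro split_nn) (auto simp: p_def exp_S S_nonneg)
  also have "\<dots> = (\<integral>\<^sup>+\<omega>. ennreal (exp (z * real (\<nu> \<omega>))) \<partial>M)"
    by (intro split_nn[symmetric]) (use \<open>0 < \<phi>\<close> in \<open>auto simp: p_def exp_z int_of_bool\<close>)
  also have "\<dots> = ennreal (expectation (\<lambda>\<omega>. exp (z * real (\<nu> \<omega>))))"
    using int_\<nu> by (intro nn_integral_eq_integral) auto
  finally have nn: "(\<integral>\<^sup>+\<omega>. ennreal (S (\<nu> \<omega>) \<omega>) \<partial>M) = ennreal (expectation (\<lambda>\<omega>. exp (z * real (\<nu> \<omega>))))" .
  have "(\<lambda>\<omega>. S (\<nu> \<omega>) \<omega>) \<in> borel_measurable M"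
    by measurable
  from nn_integral_eq_integrable[OF this, THEN iffD1, OF _ _ nn]
  show "integrable M (\<lambda>\<omega>. exp (s * (\<Sum>i=1..\<nu> \<omega>. X i \<omega>)))"
    and "expectation (\<lambda>\<omega>. exp (s * (\<Sum>i=1..\<nu> \<omega>. X i \<omega>))) = expectation (\<lambda>\<omega>. exp (z * real (\<nu> \<omega>)))"
    by (auto simp: S_def)
qed

lemma filterlim_powr_at_top:
  assumes "0 < p"
  shows "filterlim (\<lambda>x::real. x powr p) at_top at_top"
proof -
  have "filterlim (\<lambda>x::real. exp (p * ln x)) at_top at_top"
    by (intro filterlim_compose[OF exp_at_top] filterlim_tendsto_pos_mult_at_top[OF tendsto_const assms] ln_at_top)
  moreover have "\<forall>\<^sub>F x in at_top. exp (p * ln x) = x powr p"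
    using eventually_gt_at_top[of "0::real"] by eventually_elim (simp add: powr_def)
  ultimately show ?thesis
    by (simp cong: filterlim_cong)
qed

section \<open>Upper and lower bounds for the transform of the summation index\<close>

text \<open>The absolute moments divided by factorials satisfy the convolution recursion, so their
  partial generating sums are bounded uniformly. For nonnegative terms this gives summability, hence
  integrability of the exponential and the same bound for its mean.\<close>

lemma (in prob_space) mgf_of_cumulant_bound:
  fixes N :: "'a \<Rightarrow> real"
  assumes N: "random_variable borel N" and moments: "\<And>n. integrable M (\<lambda>\<omega>. N \<omega> ^ n)"
    and cumulants: "\<And>j. j \<ge> 1 \<Longrightarrow> cmod (cumulant M N j) \<le> fact j * K ^ (j - 1) * \<mu>"
    and "0 \<le> K" and z: "0 \<le> z" "K * z < 1"
  shows "integrable M (\<lambda>\<omega>. exp (z * N \<omega>))"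
    and "expectation (\<lambda>\<omega>. exp (z * N \<omega>)) \<le> exp (\<mu> * z / (1 - K * z))"
proof -
  define m where "m n = expectation (\<lambda>\<omega>. N \<omega> ^ n)" for n
  define b where "b n = \<bar>m n\<bar> / fact n" for n
  have "0 \<le> \<mu>"
    using order_trans[OF norm_ge_zero cumulants[of 1]] by simp
  have "real (Suc n) * b (Suc n) \<le> (\<Sum>j\<le>n. real (Suc j) * K ^ j * \<mu> * b (n - j))" for n
  proof -
    have "real (Suc n) * b (Suc n) = \<bar>m (Suc n)\<bar> / fact n"
      by (simp add: b_def divide_simps)
    also have "\<dots> \<le> (\<Sum>j\<le>n. real (n choose j) * (cmod (cumulant M N (Suc j)) * \<bar>m (n - j)\<bar>)) / fact n"
      unfolding m_def by (intro divide_right_mono moment_le_cumulants N moments) simp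
    \<comment> \<open>Division by \<open>fact n\<close> turns the binomial coefficient into
      \<open>1 / (fact j * fact (n - j))\<close>. The second factorial normalises the moment, and
      \<open>fact (Suc j) / fact j\<close> becomes the coefficient \<open>Suc j\<close> of the
      recursion.\<close>
    also have "\<dots> = (\<Sum>j\<le>n. cmod (cumulant M N (Suc j)) / fact j * b (n - j))"
      unfolding sum_divide_distrib
      by (intro sum.cong refl) (simp add: b_def binomial_fact field_simps)
    also have "\<dots> \<le> (\<Sum>j\<le>n. real (Suc j) * K ^ j * \<mu> * b (n - j))"
    proof (intro sum_mono mult_right_mono)
      fix j
      show "cmod (cumulant M N (Suc j)) / fact j \<le> real (Suc j) * K ^ j * \<mu>"
        using cumulants[of "Suc j"] by (simp add: divide_le_eq mult_ac)
    qed (simp add: b_def)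
    finally show ?thesis .
  qed
  then have partial: "(\<Sum>n\<le>k. b n * z ^ n) \<le> exp (\<mu> * z / (1 - K * z))" for k
    using \<open>0 \<le> K\<close> \<open>0 \<le> \<mu>\<close> z
    by (intro sum_power_le_exp_of_recursion) (auto simp: b_def m_def prob_space)
  have partial': "(\<Sum>n<k. b n * z ^ n) \<le> exp (\<mu> * z / (1 - K * z))" for k
    by (rule order_trans[OF _ partial[of k]], rule sum_mono2) (use z in \<open>auto simp: b_def\<close>)
  have summable_b: "summable (\<lambda>n. b n * z ^ n)"
    by (rule summableI_nonneg_bounded[OF _ partial']) (use z in \<open>simp add: b_def\<close>)
  then have summable: "summable (\<lambda>n. \<bar>z\<bar> ^ n * \<bar>m n\<bar> / fact n)"
    using z by (simp add: b_def mult_ac)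
  show "integrable M (\<lambda>\<omega>. exp (z * N \<omega>))"
    using N moments summable unfolding m_def by (rule mgf_of_summable_moments)
  have "(\<lambda>n. z ^ n * m n / fact n) sums expectation (\<lambda>\<omega>. exp (z * N \<omega>))"
    using N moments summable unfolding m_def by (rule mgf_of_summable_moments)
  moreover have "z ^ n * m n / fact n \<le> b n * z ^ n" for n
    using z mult_right_mono[OF abs_ge_self[of "m n"] zero_le_power[OF z(1), of n]]
    by (simp add: b_def divide_right_mono mult.commute)
  ultimately have "expectation (\<lambda>\<omega>. exp (z * N \<omega>)) \<le> (\<Sum>n. b n * z ^ n)"
    using summable_b by (intro sums_le[OF _ _ summable_sums]) auto
  also have "\<dots> \<le> exp (\<mu> * z / (1 - K * z))"
    using summable_b partial' by (rule suminf_le_const)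
  finally show "expectation (\<lambda>\<omega>. exp (z * N \<omega>)) \<le> exp (\<mu> * z / (1 - K * z))" .
qed

text \<open>Jensen's inequality by integrating the tangent line at the mean. It serves twice: for a
  centred summand it makes the logarithm of the transform nonnegative, and for the index it gives
  the lower bound.\<close>

lemma (in prob_space) exp_expectation_le_mgf:
  fixes N :: "'a \<Rightarrow> real"
  assumes "integrable M N" "integrable M (\<lambda>\<omega>. exp (z * N \<omega>))"
  shows "exp (z * expectation N) \<le> expectation (\<lambda>\<omega>. exp (z * N \<omega>))"
proof -
  let ?e = "expectation N"
  have "exp (z * ?e) = expectation (\<lambda>\<omega>. exp (z * ?e) * (1 + z * (N \<omega> - ?e)))"
    using assms(1) by (simp add: prob_space)
  also have "\<dots> \<le> expectation (\<lambda>\<omega>. exp (z * N \<omega>))"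
  proof (rule integral_mono)
    fix \<omega>
    have "exp (z * ?e) * (1 + z * (N \<omega> - ?e)) \<le> exp (z * ?e) * exp (z * (N \<omega> - ?e))"
      by (intro mult_left_mono exp_ge_add_one_self) simp
    also have "\<dots> = exp (z * N \<omega>)"
      unfolding exp_add[symmetric] by (simp add: algebra_simps)
    finally show "exp (z * ?e) * (1 + z * (N \<omega> - ?e)) \<le> exp (z * N \<omega>)" .
  qed (use assms in auto)
  finally show ?thesis .
qed

section \<open>The moderate deviation principle for random sums\<close>

theorem mainTheorem4:
  fixes M :: "'a measure"
    and X :: "nat \<Rightarrow> 'a \<Rightarrow> real"
    and \<nu> :: "nat \<Rightarrow> 'a \<Rightarrow> nat"
    and \<mu> :: "nat \<Rightarrow> real"
    and K\<^sub>1 K\<^sub>2 \<alpha> :: real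
  assumes "prob_space M"
    and X_indep: "prob_space.indep_vars M (\<lambda>_. borel) X {1..}"
    and X_ident: "\<And>i. i \<ge> 1 \<Longrightarrow> distr M borel (X i) = distr M borel (X 1)"
    and X_moments: "\<And>j. integrable M (\<lambda>\<omega>. X 1 \<omega> ^ j)"
    and X_mean: "prob_space.expectation M (X 1) = 0"
    and X_var: "prob_space.variance M (X 1) = 1"
    and \<nu>_pos: "\<And>k \<omega>. k \<ge> 1 \<Longrightarrow> \<omega> \<in> space M \<Longrightarrow> \<nu> k \<omega> \<ge> 1"
    and \<nu>_moments: "\<And>k j. k \<ge> 1 \<Longrightarrow> integrable M (\<lambda>\<omega>. real (\<nu> k \<omega>) ^ j)"
    and \<nu>_X_indep: "\<And>k. k \<ge> 1 \<Longrightarrow>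
      indep_rvs M (count_space UNIV) (\<nu> k)
        (Pi\<^sub>M {1..} (\<lambda>_. borel)) (\<lambda>\<omega>. \<lambda>i\<in>{1..}. X i \<omega>)"
    and \<mu>_def: "\<And>k. k \<ge> 1 \<Longrightarrow> \<mu> k = prob_space.expectation M (\<lambda>\<omega>. real (\<nu> k \<omega>))"
    and \<mu>_lim: "filterlim \<mu> at_top sequentially"
    and "K\<^sub>1 \<ge> 0" and "K\<^sub>2 \<ge> 0"
    and X_bound: "\<And>j. j \<ge> 3 \<Longrightarrow>
      \<bar>prob_space.expectation M (\<lambda>\<omega>. X 1 \<omega> ^ j)\<bar> \<le> fact j * K\<^sub>1 ^ (j - 2)"
    and \<nu>_bound: "\<And>j k. j \<ge> 1 \<Longrightarrow> k \<ge> 1 \<Longrightarrow>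
      cmod (cumulant M (\<lambda>\<omega>. real (\<nu> k \<omega>)) j) \<le> fact j * K\<^sub>2 ^ (j - 1) * \<mu> k"
    and "0 < \<alpha>" and "\<alpha> < 1/2"
  shows "satisfies_MDP M
      (\<lambda>k \<omega>. 1 / \<mu> k powr (1/2 + \<alpha>) * (\<Sum>i=1..\<nu> k \<omega>. X i \<omega>))
      (\<lambda>k. \<mu> k powr (2 * \<alpha>))
      (\<lambda>x. ereal (x\<^sup>2 / 2))"
proof -
  interpret prob_space M by fact
  have X_rv [measurable]: "random_variable borel (X i)" if "i \<ge> 1" for i
    using X_indep that by (auto simp: indep_vars_def)
  have \<nu>_rv [measurable]: "\<nu> k \<in> measurable M (count_space UNIV)" if "k \<ge> 1" for k
    using \<nu>_X_indep[OF that] by (simp add: indep_rvs_def)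
  have X_sq: "expectation (\<lambda>\<omega>. X 1 \<omega> ^ 2) = 1"
    using X_var X_mean by simp
  define \<phi> where "\<phi> s = expectation (\<lambda>\<omega>. exp (s * X 1 \<omega>))" for s
  define z where "z s = ln (\<phi> s)" for s
  have int_X: "integrable M (\<lambda>\<omega>. exp (s * X 1 \<omega>))"
    and \<phi>_bound: "\<bar>\<phi> s - 1 - s\<^sup>2 / 2\<bar> \<le> s\<^sup>2 * (K\<^sub>1 * \<bar>s\<bar> / (1 - K\<^sub>1 * \<bar>s\<bar>))" if "K\<^sub>1 * \<bar>s\<bar> < 1" for s
    using mgf_quadratic_expansion[OF X_rv[of 1] X_moments X_mean X_sq X_bound \<open>K\<^sub>1 \<ge> 0\<close> that]
    by (auto simp: \<phi>_def)
  \<comment> \<open>This sign is what admits \<open>z s\<close> as an argument in the cumulant bound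
    for the index, which covers nonnegative exponents.\<close>
  have z_nonneg: "0 \<le> z s" if "K\<^sub>1 * \<bar>s\<bar> < 1" for s
    using exp_expectation_le_mgf[OF _ int_X[OF that]] X_moments[of 1] X_mean by (simp add: z_def \<phi>_def)
  have z_lim: "((\<lambda>s. z s / s\<^sup>2) \<longlongrightarrow> 1 / 2) (at 0)"
    unfolding z_def using \<open>K\<^sub>1 \<ge> 0\<close> \<phi>_bound by (rule tendsto_ln_over_square)
  let ?S = "\<lambda>k \<omega>. \<Sum>i=1..\<nu> k \<omega>. X i \<omega>"
  have int_S: "integrable M (\<lambda>\<omega>. exp (s * ?S k \<omega>))"
    and S_ge: "\<mu> k * z s \<le> ln (expectation (\<lambda>\<omega>. exp (s * ?S k \<omega>)))"
    and S_le: "ln (expectation (\<lambda>\<omega>. exp (s * ?S k \<omega>))) \<le> \<mu> k * z s / (1 - K\<^sub>2 * z s)"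
    if "k \<ge> 1" and s: "K\<^sub>1 * \<bar>s\<bar> < 1" "K\<^sub>2 * z s < 1" for k s
  proof -
    let ?N = "\<lambda>\<omega>. real (\<nu> k \<omega>)"
    have N: "random_variable borel ?N"
      using \<nu>_rv[OF \<open>k \<ge> 1\<close>] by measurable
    note N_mgf = mgf_of_cumulant_bound[OF N \<nu>_moments[OF \<open>k \<ge> 1\<close>] \<nu>_bound[OF _ \<open>k \<ge> 1\<close>] \<open>K\<^sub>2 \<ge> 0\<close>
        z_nonneg[OF s(1)] s(2)]
    note sum = mgf_random_sum[OF X_indep X_ident \<nu>_X_indep[OF \<open>k \<ge> 1\<close>] int_X[OF s(1)],
        folded \<phi>_def, folded z_def, OF _ N_mgf(1)]
    show int_S: "integrable M (\<lambda>\<omega>. exp (s * ?S k \<omega>))"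
      using sum(1) by simp
    have eq: "expectation (\<lambda>\<omega>. exp (s * ?S k \<omega>)) = expectation (\<lambda>\<omega>. exp (z s * ?N \<omega>))"
      using sum(2) by simp
    have pos: "0 < expectation (\<lambda>\<omega>. exp (z s * ?N \<omega>))"
      by (rule expectation_exp_pos[OF N_mgf(1)])
    have "exp (\<mu> k * z s) \<le> expectation (\<lambda>\<omega>. exp (z s * ?N \<omega>))"
      using exp_expectation_le_mgf[OF _ N_mgf(1)] \<nu>_moments[OF \<open>k \<ge> 1\<close>, of 1] \<mu>_def[OF \<open>k \<ge> 1\<close>]
      by (simp add: mult.commute)
    then show "\<mu> k * z s \<le> ln (expectation (\<lambda>\<omega>. exp (s * ?S k \<omega>)))"
      unfolding eq using pos by (simp add: ln_ge_iff)
    show "ln (expectation (\<lambda>\<omega>. exp (s * ?S k \<omega>))) \<le> \<mu> k * z s / (1 - K\<^sub>2 * z s)"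
      unfolding eq using N_mgf(2) pos by (metis ln_le_cancel_iff exp_gt_zero ln_exp)
  qed

  have \<mu>_pos: "\<forall>\<^sub>F k in sequentially. 0 < \<mu> k"
    using \<mu>_lim by (simp add: filterlim_at_top_dense)
  \<comment> \<open>The tilt \<open>t\<close> times the speed, combined with the normalisation, is
    an exponent for the unnormalised sum:
    \<open>2 * \<alpha> - (1/2 + \<alpha>) = \<alpha> - 1/2\<close>. This power is negative since
    \<open>\<alpha> < 1/2\<close>, so only the transforms near 0 matter.\<close>
  define s where "s t k = t * \<mu> k powr (\<alpha> - 1/2)" for t k
  have s_scale: "t * \<mu> k powr (2 * \<alpha>) * (1 / \<mu> k powr (1/2 + \<alpha>) * y) = s t k * y" if "0 < \<mu> k" for t k y
  proof -
    have "\<mu> k powr (2 * \<alpha>) / \<mu> k powr (1/2 + \<alpha>) = \<mu> k powr (\<alpha> - 1/2)"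
      by (simp flip: powr_diff add: algebra_simps)
    then show ?thesis
      unfolding s_def by (simp flip: \<open>_ = \<mu> k powr (\<alpha> - 1/2)\<close>)
  qed
  have s_sq: "(s t k)\<^sup>2 * \<mu> k / \<mu> k powr (2 * \<alpha>) = t\<^sup>2" if "0 < \<mu> k" for t k
  proof -
    have "(\<mu> k powr (\<alpha> - 1/2))\<^sup>2 * \<mu> k = \<mu> k powr ((\<alpha> - 1/2) + (\<alpha> - 1/2) + 1)"
      unfolding powr_add power2_eq_square using that by simp
    then have "(\<mu> k powr (\<alpha> - 1/2))\<^sup>2 * \<mu> k = \<mu> k powr (2 * \<alpha>)"
      by (simp add: algebra_simps)
    then show ?thesis
      using that by (simp add: s_def power_mult_distrib mult.assoc)
  qed
  have s_lim: "s t \<longlonglongrightarrow> 0" for t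
  proof -
    have "(\<lambda>k. \<mu> k powr (\<alpha> - 1/2)) \<longlonglongrightarrow> 0"
      using \<open>\<alpha> < 1/2\<close> \<mu>_lim by (intro tendsto_neg_powr) auto
    from tendsto_mult_left[OF this, of t] show ?thesis
      by (simp add: s_def[abs_def])
  qed
  have K1_small: "\<forall>\<^sub>F k in sequentially. K\<^sub>1 * \<bar>s t k\<bar> < 1" for t
  proof -
    have "(\<lambda>k. K\<^sub>1 * \<bar>s t k\<bar>) \<longlonglongrightarrow> K\<^sub>1 * \<bar>0\<bar>"
      by (intro tendsto_intros s_lim)
    then show ?thesis by (rule order_tendstoD) simp
  qed
  \<comment> \<open>The limit \<open>z_lim\<close> is punctured at 0. The tilt \<open>t = 0\<close>,
    for which \<open>s t k\<close> vanishes, is treated separately below through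
    \<open>z 0 = ln 1 = 0\<close>.\<close>
  have ratio_lim: "(\<lambda>k. z (s t k) / (s t k)\<^sup>2) \<longlonglongrightarrow> 1 / 2" if "t \<noteq> 0" for t
  proof (rule filterlim_compose[OF z_lim filterlim_atI[OF s_lim]])
    show "\<forall>\<^sub>F k in sequentially. s t k \<noteq> 0"
      using \<mu>_pos by eventually_elim (use \<open>t \<noteq> 0\<close> in \<open>simp add: s_def\<close>)
  qed
  have zs_lim: "(\<lambda>k. z (s t k)) \<longlonglongrightarrow> 0" for t
  proof (cases "t = 0")
    case False
    have "(\<lambda>k. z (s t k) / (s t k)\<^sup>2 * (s t k)\<^sup>2) \<longlonglongrightarrow> 1 / 2 * 0\<^sup>2"
      by (intro tendsto_intros ratio_lim s_lim False)
    moreover have "\<forall>\<^sub>F k in sequentially. z (s t k) / (s t k)\<^sup>2 * (s t k)\<^sup>2 = z (s t k)"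
      using \<mu>_pos by eventually_elim (use False in \<open>simp add: s_def\<close>)
    ultimately show ?thesis
      using Lim_transform_eventually by fastforce
  qed (simp add: s_def z_def \<phi>_def prob_space)
  have K2_small: "\<forall>\<^sub>F k in sequentially. K\<^sub>2 * z (s t k) < 1" for t
  proof -
    have "(\<lambda>k. K\<^sub>2 * z (s t k)) \<longlonglongrightarrow> K\<^sub>2 * 0"
      by (intro tendsto_intros zs_lim)
    then show ?thesis by (rule order_tendstoD) simp
  qed
  \<comment> \<open>By \<open>s_sq\<close> the sequence is \<open>t\<^sup>2\<close> times the
    quotient \<open>z (s t k) / (s t k)\<^sup>2\<close>, which tends to 1/2.\<close>
  have main_lim: "(\<lambda>k. \<mu> k * z (s t k) / \<mu> k powr (2 * \<alpha>)) \<longlonglongrightarrow> t\<^sup>2 / 2" for t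
  proof (cases "t = 0")
    case False
    have "(\<lambda>k. t\<^sup>2 * (z (s t k) / (s t k)\<^sup>2)) \<longlonglongrightarrow> t\<^sup>2 * (1 / 2)"
      by (intro tendsto_intros ratio_lim False)
    moreover have "\<forall>\<^sub>F k in sequentially. t\<^sup>2 * (z (s t k) / (s t k)\<^sup>2) = \<mu> k * z (s t k) / \<mu> k powr (2 * \<alpha>)"
      using \<mu>_pos
    proof eventually_elim
      case (elim k)
      then have "s t k \<noteq> 0" using False by (simp add: s_def)
      then show ?case
        unfolding s_sq[OF elim, of t, symmetric] by simp
    qed
    ultimately show ?thesis
      using Lim_transform_eventually by fastforce
  qed (simp add: s_def z_def \<phi>_def prob_space)

  let ?Z = "\<lambda>k \<omega>. 1 / \<mu> k powr (1/2 + \<alpha>) * ?S k \<omega>"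
  show ?thesis
  proof (rule MDP_of_quadratic_log_mgf)
    fix k :: nat assume "k \<ge> 1"
    note [measurable] = \<nu>_rv[OF \<open>k \<ge> 1\<close>]
    have "(\<lambda>\<omega>. \<Sum>i=1..n. X i \<omega>) \<in> borel_measurable M" for n
      using X_rv by (intro borel_measurable_sum) simp
    then have "(\<lambda>\<omega>. ?S k \<omega>) \<in> borel_measurable M"
      by (rule measurable_compose_countable[OF _ \<nu>_rv[OF \<open>k \<ge> 1\<close>]])
    then show "?Z k \<in> borel_measurable M"
      by (intro borel_measurable_times) simp_all
  next
    show "filterlim (\<lambda>k. \<mu> k powr (2 * \<alpha>)) at_top sequentially"
      using \<open>0 < \<alpha>\<close> by (intro filterlim_compose[OF filterlim_powr_at_top \<mu>_lim]) simp
  next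
    fix t :: real
    have ev1: "\<forall>\<^sub>F k in sequentially. k \<ge> (1::nat)"
      by (rule eventually_ge_at_top)
    show "\<forall>\<^sub>F k in sequentially. integrable M (\<lambda>\<omega>. exp (t * \<mu> k powr (2 * \<alpha>) * ?Z k \<omega>))"
      using ev1 \<mu>_pos K1_small[of t] K2_small[of t]
      by eventually_elim (simp only: s_scale int_S)
    let ?\<Lambda> = "\<lambda>k. ln (expectation (\<lambda>\<omega>. exp (t * \<mu> k powr (2 * \<alpha>) * ?Z k \<omega>))) / \<mu> k powr (2 * \<alpha>)"
    show "?\<Lambda> \<longlonglongrightarrow> t\<^sup>2 / 2"
    \<comment> \<open>The Jensen and cumulant bounds differ only by the factor
      \<open>1 / (1 - K\<^sub>2 * z (s t k))\<close>, which tends to 1.\<close>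
    proof (rule tendsto_sandwich)
      show "\<forall>\<^sub>F k in sequentially. \<mu> k * z (s t k) / \<mu> k powr (2 * \<alpha>) \<le> ?\<Lambda> k"
        using ev1 \<mu>_pos K1_small[of t] K2_small[of t]
        by eventually_elim (simp only: s_scale, intro divide_right_mono S_ge powr_ge_zero)
      show "\<forall>\<^sub>F k in sequentially.
          ?\<Lambda> k \<le> \<mu> k * z (s t k) / (1 - K\<^sub>2 * z (s t k)) / \<mu> k powr (2 * \<alpha>)"
        using ev1 \<mu>_pos K1_small[of t] K2_small[of t]
        by eventually_elim (simp only: s_scale, intro divide_right_mono S_le powr_ge_zero)
      show "(\<lambda>k. \<mu> k * z (s t k) / \<mu> k powr (2 * \<alpha>)) \<longlonglongrightarrow> t\<^sup>2 / 2"
        by (rule main_lim)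
      have "(\<lambda>k. \<mu> k * z (s t k) / \<mu> k powr (2 * \<alpha>) / (1 - K\<^sub>2 * z (s t k))) \<longlonglongrightarrow> t\<^sup>2 / 2 / (1 - K\<^sub>2 * 0)"
        by (intro tendsto_intros main_lim zs_lim) simp
      then show "(\<lambda>k. \<mu> k * z (s t k) / (1 - K\<^sub>2 * z (s t k)) / \<mu> k powr (2 * \<alpha>)) \<longlonglongrightarrow> t\<^sup>2 / 2"
        by (simp add: divide_divide_eq_left mult.commute)
    qed
  qed
qed

end
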